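(* Let $\alpha,\nu>0$ be fixed and suppose that either (i) $\frac12<\alpha<1$ and $\nu>0$ is arbitrary, or (ii) $\alpha=1$ and $\nu$ is sufficiently large (that is, $\nu>\nu_0$ for some absolute constant $\nu_0$ whose existence is part of the claim). Then, asymptotically almost surely as $N\to\infty$, every component of $G(N;\alpha,\nu)$ has diameter $O(\log N)$. That is, there is a constant $C=C(\alpha,\nu)$ such that $$\lim_{N\to\infty}\mathbb{P}\big(\text{every connected component of } G(N;\alpha,\nu) \text{ has graph diameter at most } C\log N\big)=1.$$
   Context: The KPKVB random graph $G(N;\alpha,\nu)$ (for $\alpha,\nu>0$ and integers $N>\nu$): set $R=2\log(N/\nu)$. Points of the hyperbolic plane (Poincaré disk with metric $ds^2=4\frac{dx^2+dy^2}{(1-x^2-y^2)^2}$, i.e. curvature $-1$) are written in polar coordinates $(r,\vartheta)$, where $r\ge 0$ is the hyperbolic distance to the origin and $\vartheta\in(-\pi,\pi]$ is the angle; the hyperbolic distance $d$ between $(r,\vartheta)$ and $(r',\vartheta')$ satisfies $\cosh d=\cosh r\cosh r'-\sinh r\sinh r'\cos(\vartheta-\vartheta')$. The vertices of $G(N;\alpha,\nu)$ are $N$ independent random points in the disk $\mathcal D_R$ of hyperbolic radius $R$ around the origin, each having (in the coordinates $(r,\vartheta)$) probability density $$f(r,\vartheta)=\frac1{2\pi}\,\frac{\alpha\sinh(\alpha r)}{\cosh(\alpha R)-1},\qquad r\in[0,R],\ \vartheta\in(-\pi,\pi].$$ Two distinct vertices are joined by an edge if and only if their hyperbolic distance is at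 most $R$. The diameter of a connected graph is the maximum graph distance between two of its vertices. *)

theory Defs
  imports "HOL-Probability.Probability" "Graph_Theory.Graph_Theory"
begin

text \<open>Points of the hyperbolic plane are given by native polar coordinates \<open>(r, \<theta>)\<close>, where \<open>r\<close> is
  the hyperbolic distance to the origin.\<close>

definition hyp_dist :: "real \<times> real \<Rightarrow> real \<times> real \<Rightarrow> real" where
  "hyp_dist = (\<lambda>(r, \<theta>) (r', \<theta>'). arcosh (cosh r * cosh r' - sinh r * sinh r' * cos (\<theta> - \<theta>')))"

lemma hyp_dist_nonneg_cosh:
  assumes "r \<ge> 0" "r' \<ge> 0"
  shows "hyp_dist (r, \<theta>) (r', \<theta>') \<ge> 0"
    and "cosh (hyp_dist (r, \<theta>) (r', \<theta>')) = cosh r * cosh r' - sinh r * sinh r' * cos (\<theta> - \<theta>')"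
proof -
  have "sinh r * sinh r' * cos (\<theta> - \<theta>') \<le> sinh r * sinh r' * 1"
    using assms by (intro mult_left_mono) auto
  moreover have "cosh r * cosh r' - sinh r * sinh r' = cosh (r - r')"
    by (simp add: cosh_diff)
  moreover have "cosh (r - r') \<ge> 1"
    by (rule cosh_real_ge_1)
  ultimately have "cosh r * cosh r' - sinh r * sinh r' * cos (\<theta> - \<theta>') \<ge> 1"
    by linarith
  then show "hyp_dist (r, \<theta>) (r', \<theta>') \<ge> 0"
    and "cosh (hyp_dist (r, \<theta>) (r', \<theta>')) = cosh r * cosh r' - sinh r * sinh r' * cos (\<theta> - \<theta>')"
    by (simp_all add: hyp_dist_def)
qed

definition kpkvb_radius :: "real \<Rightarrow> nat \<Rightarrow> real" where
  "kpkvb_radius \<nu> N = 2 * ln (real N / \<nu>)"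

definition kpkvb_density :: "real \<Rightarrow> real \<Rightarrow> real \<times> real \<Rightarrow> real" where
  "kpkvb_density \<alpha> R = (\<lambda>(r, \<theta>). if r \<in> {0..R} \<and> \<theta> \<in> {-pi<..pi}
     then 1 / (2 * pi) * (\<alpha> * sinh (\<alpha> * r) / (cosh (\<alpha> * R) - 1)) else 0)"

text \<open>The density is with respect to \<open>dr d\<theta>\<close>, that is, Lebesgue measure on the coordinates.\<close>

definition kpkvb_point :: "real \<Rightarrow> real \<Rightarrow> (real \<times> real) measure" where
  "kpkvb_point \<alpha> R = density lborel (\<lambda>p. ennreal (kpkvb_density \<alpha> R p))"

definition kpkvb_points :: "real \<Rightarrow> real \<Rightarrow> nat \<Rightarrow> (nat \<Rightarrow> real \<times> real) measure" where
  "kpkvb_points \<alpha> \<nu> N = (\<Pi>\<^sub>M i\<in>{..<N}. kpkvb_point \<alpha> (kpkvb_radius \<nu> N))"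

text \<open>The vertices are the indices of the points, so that there are always exactly \<open>N\<close> of them. As
  usual in the graph library, an undirected edge is a pair of opposite arcs.\<close>

definition kpkvb_graph :: "real \<Rightarrow> nat \<Rightarrow> (nat \<Rightarrow> real \<times> real) \<Rightarrow> nat pair_pre_digraph" where
  "kpkvb_graph \<nu> N X = \<lparr> pverts = {..<N},
     parcs = {(i, j). i < N \<and> j < N \<and> i \<noteq> j \<and> hyp_dist (X i) (X j) \<le> kpkvb_radius \<nu> N} \<rparr>"

definition graph_components :: "('a, 'b) pre_digraph \<Rightarrow> ('a, 'b) pre_digraph set" where
  "graph_components G = {H. pre_digraph.max_subgraph G Digraph_Component.connected H}"

definition graph_dist :: "('a, 'b) pre_digraph \<Rightarrow> 'a \<Rightarrow> 'a \<Rightarrow> ereal" where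
  "graph_dist G = wf_digraph.\<mu> G (\<lambda>_. 1)"

text \<open>For a finite nonempty graph the suprema are maxima.\<close>

definition graph_diameter :: "('a, 'b) pre_digraph \<Rightarrow> ereal" where
  "graph_diameter G = (SUP u\<in>verts G. SUP v\<in>verts G. graph_dist G u v)"

lemma pair_graph_kpkvb_graph: "pair_graph (kpkvb_graph \<nu> N X)"
proof
  have "hyp_dist p q = hyp_dist q p" for p q
    by (cases p; cases q) (simp add: hyp_dist_def mult.commute cos_diff)
  then show "symmetric (with_proj (kpkvb_graph \<nu> N X))"
    by (auto simp: symmetric_def sym_def kpkvb_graph_def)
  have "parcs (kpkvb_graph \<nu> N X) \<subseteq> {..<N} \<times> {..<N}"
    by (auto simp: kpkvb_graph_def)
  then show "finite (parcs (kpkvb_graph \<nu> N X))"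
    by (rule finite_subset) simp
qed (auto simp: kpkvb_graph_def)

lemma prob_space_kpkvb_point:
  assumes "\<alpha> > 0" "R > 0"
  shows "prob_space (kpkvb_point \<alpha> R)"
proof -
  define c where "c = cosh (\<alpha> * R) - 1"
  have "cosh (\<alpha> * R) > 1"
    using cosh_real_strict_mono[of 0 "\<alpha> * R"] assms by simp
  then have c: "c > 0"
    by (simp add: c_def)
  let ?f = "\<lambda>r. \<alpha> * sinh (\<alpha> * r) / c"
  have nn: "?f r \<ge> 0" if "r \<ge> 0" for r
    using that c assms by simp
  have der: "((\<lambda>r. cosh (\<alpha> * r) / c) has_real_derivative ?f r) (at r)" for r
    by (use c in \<open>auto intro!: derivative_eq_intros\<close>)
  have [measurable]: "?f \<in> borel_measurable borel"
    by (intro borel_measurable_continuous_onI continuous_intros) (use c in auto)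
  have "(\<integral>\<^sup>+r. ennreal (?f r) * indicator {0..R} r \<partial>lborel)
      = ennreal (cosh (\<alpha> * R) / c - cosh (\<alpha> * 0) / c)"
    using assms by (intro nn_integral_FTC_Icc) (auto intro!: nn der has_field_derivative_at_within)
  also have "cosh (\<alpha> * R) / c - cosh (\<alpha> * 0) / c = 1"
    using c by (simp add: diff_divide_distrib[symmetric] flip: c_def)
  finally have 1: "(\<integral>\<^sup>+r. ennreal (?f r) * indicator {0..R} r \<partial>lborel) = 1"
    by simp
  have 2: "(\<integral>\<^sup>+\<theta>. ennreal (1 / (2 * pi)) * indicator {-pi<..pi} \<theta> \<partial>lborel) = 1"
    by (simp add: nn_integral_cmult_indicator flip: ennreal_mult)
  have eq: "ennreal (kpkvb_density \<alpha> R (r, \<theta>)) = (ennreal (?f r) * indicator {0..R} r)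
      * (ennreal (1 / (2 * pi)) * indicator {-pi<..pi} \<theta>)" for r \<theta>
    using nn[of r] by (auto simp: kpkvb_density_def c_def mult.commute simp flip: ennreal_mult)
  have meas: "(\<lambda>p. ennreal (kpkvb_density \<alpha> R p)) \<in> borel_measurable (lborel \<Otimes>\<^sub>M lborel)"
  proof -
    have "(\<lambda>p. ennreal (kpkvb_density \<alpha> R p)) =
      (\<lambda>p. (ennreal (?f (fst p)) * indicator {0..R} (fst p))
      * (ennreal (1 / (2 * pi)) * indicator {-pi<..pi} (snd p)))"
      using eq by (auto simp: fun_eq_iff)
    then show ?thesis
      by simp
  qed
  have "emeasure (kpkvb_point \<alpha> R) (space (kpkvb_point \<alpha> R))
      = (\<integral>\<^sup>+p. ennreal (kpkvb_density \<alpha> R p) \<partial>(lborel \<Otimes>\<^sub>M lborel))"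
    using meas by (simp add: kpkvb_point_def emeasure_density lborel_prod)
  also have "\<dots> = (\<integral>\<^sup>+r. (\<integral>\<^sup>+\<theta>. ennreal (kpkvb_density \<alpha> R (r, \<theta>)) \<partial>lborel) \<partial>lborel)"
    using meas by (rule lborel.nn_integral_fst[symmetric])
  also have "\<dots> = 1"
    unfolding eq by (subst nn_integral_cmult) (simp_all add: 1 2)
  finally show ?thesis
    by (rule prob_spaceI)
qed

end

(* The disk is cut into boxes that shrink by a factor of two with the distance from the origin, down to
   a constant height h above the boundary; points in equal or adjacent boxes are joined by an edge. Given
   two vertices u and v of one component, let D consist of the boxes close to the rays from the origin
   through u and v, and of the connected sets of empty boxes that meet them. The claim is that the distance
   of u and v is O(|D|). Otherwise some shell of constant width around u, in the graph metric, avoids all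
   vertices close to D, because these are covered by O(|D|) cliques. Colour the vertices by lying inside or
   outside of the shell. The colour is constant near each vertex close to D. The change of colour along
   the boundary of the empty boxes in D is a cocycle mod 2 on the triangulated complex of boxes, hence has a
   potential, since the complex is simply connected. Following this potential along a path in the graph from
   u to v, and along the rays via the origin, shows that u and v have the same colour, a contradiction.

   So if the distance is at least C log N, then D contains a connected set of m boxes including the
   central one, with m of order log N, of which at most O(log N) < m/2 are nonempty. There are at most
   exp(O(m)) such sets, and each box is empty with probability at most exp(-c), where c is large for alpha < 1
   because h is, and for alpha = 1 because nu is. *)
theory Submission
  imports Defs
begin

text \<open>The obstacle is that edges of the graph are not edges of the box complex: they may join
  distant boxes, and vertices close to the boundary of the disk lie in no box at all. Hence the
  potential, which lives on boxes, is transported along an edge by a detour towards the origin. All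
  vertices in the boxes above the edge are adjacent to one of its ends, so wherever the detour
  borders on a hole, the colour there is the colour of the edge. Below the boxes, base points take
  over: an edge cannot pass one without its ends being adjacent to a vertex there. One case escapes:
  a component might be caught below active boxes of the other colour. It is excluded because a
  component with both \<open>u\<close> and \<open>v\<close>, coloured differently, contains both
  colours. The constants are squeezed from two sides: boxes must be small for cliques 12 levels
  apart, yet large enough that the ends of an edge lie in neighbouring columns 12 levels up.\<close>

section \<open>Boxes and the two-colouring argument\<close>

text \<open>The box \<open>(d, k)\<close> lies at depth \<open>d\<close> over the angular interval \<open>[k, k + 1) / 2 ^ d\<close>, where angles
  are measured in full turns and live on the universal cover of the circle: \<open>(d, k)\<close> and
  \<open>(d, k + 2 ^ d)\<close> are the same box, and a vertex has the angles \<open>t\<close> with \<open>t - pos v \<in> \<int>\<close>. Adjacency of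
  boxes includes equality and is triangulated: two adjacent boxes at depth \<open>d + 1\<close> have adjacent parents.\<close>

type_synonym box = "nat \<times> int"

definition boxadj :: "box \<Rightarrow> box \<Rightarrow> bool" where
  "boxadj b c \<longleftrightarrow> fst b = fst c \<and> \<bar>snd b - snd c\<bar> \<le> 1
     \<or> fst b = Suc (fst c) \<and> \<bar>snd b div 2 - snd c\<bar> \<le> 1
     \<or> fst c = Suc (fst b) \<and> \<bar>snd c div 2 - snd b\<bar> \<le> 1"

lemma boxadj_refl [simp]: "boxadj b b"
  by (simp add: boxadj_def)

lemma boxadj_sym: "boxadj b c \<Longrightarrow> boxadj c b"
  by (auto simp: boxadj_def)

definition col :: "nat \<Rightarrow> real \<Rightarrow> int" where
  "col j t = \<lfloor>2 ^ j * t\<rfloor>"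

lemma col_Suc_div: "col (Suc j) t div 2 = col j t"
proof -
  have "\<lfloor>2 * x\<rfloor> div 2 = \<lfloor>x\<rfloor>" for x :: real
    by linarith
  from this[of "2 ^ j * t"] show ?thesis
    by (simp add: col_def mult.assoc)
qed

lemma col_add_div: "col (j + m) t div 2 ^ m = col j t"
proof (induction m)
  case (Suc m)
  have "col (j + Suc m) t div 2 ^ Suc m = col (Suc (j + m)) t div 2 div 2 ^ m"
    by (simp add: zdiv_zmult2_eq)
  with Suc show ?case
    by (simp add: col_Suc_div)
qed simp

lemma near_div:
  fixes x y :: int
  assumes "\<bar>x - y\<bar> \<le> 1" "m > 0"
  shows "\<bar>x div m - y div m\<bar> \<le> 1"
proof -
  have "(z + 1) div m \<le> z div m + 1" for z
  proof -
    have "(z + 1) div m \<le> (z + m) div m"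
      using assms(2) by (intro zdiv_mono1) auto
    then show ?thesis
      using assms(2) by simp
  qed
  moreover have "x div m \<le> (y + 1) div m" "y div m \<le> (x + 1) div m"
    using assms by (auto intro!: zdiv_mono1)
  ultimately show ?thesis
    by (smt (verit))
qed

lemma col_mono: "s \<le> t \<Longrightarrow> col j s \<le> col j t"
  by (simp add: col_def floor_mono)

lemma col_less_imp_less: "col j s < col j t \<Longrightarrow> s < t"
  by (meson col_mono not_less)

section \<open>Boxes on the universal cover, rays and holes\<close>

locale box_graph =
  fixes V :: "'v set" and adj :: "'v rel" and dep :: "'v \<Rightarrow> nat" and pos :: "'v \<Rightarrow> real" and l :: nat
begin

definition lift :: "'v \<Rightarrow> real \<Rightarrow> bool" where
  "lift v t \<longleftrightarrow> t - pos v \<in> \<int>"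

definition inbox :: "'v \<Rightarrow> box \<Rightarrow> bool" where
  "inbox v b \<longleftrightarrow> v \<in> V \<and> dep v = fst b \<and> (\<exists>t. lift v t \<and> col (fst b) t = snd b)"

definition active :: "box \<Rightarrow> bool" where
  "active b \<longleftrightarrow> (\<exists>v. inbox v b)"

definition rays :: "'v \<Rightarrow> 'v \<Rightarrow> box set" where
  "rays u v = {b. fst b \<le> l \<and> (\<exists>w\<in>{u, v}. \<exists>t. lift w t \<and> \<bar>snd b - col (fst b) t\<bar> \<le> 1)}"

inductive_set holes :: "'v \<Rightarrow> 'v \<Rightarrow> box set" for u v where
  start: "b \<in> rays u v \<Longrightarrow> \<not> active b \<Longrightarrow> b \<in> holes u v"
| step: "b \<in> holes u v \<Longrightarrow> boxadj b c \<Longrightarrow> fst c \<le> l \<Longrightarrow> \<not> active c \<Longrightarrow> c \<in> holes u v"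

text \<open>A vertex of depth more than \<open>l\<close> lies in no box; it counts for the box at depth \<open>l\<close> above it.\<close>

definition touched :: "'v \<Rightarrow> 'v \<Rightarrow> 'v set" where
  "touched u v = {w \<in> V. \<exists>t c. lift w t \<and> c \<in> rays u v \<union> holes u v
     \<and> boxadj (min (dep w) l, col (min (dep w) l) t) c}"

lemma holesD: "b \<in> holes u v \<Longrightarrow> fst b \<le> l \<and> \<not> active b"
  by (induction rule: holes.induct) (auto simp: rays_def)

lemma lift_pos [simp]: "lift v (pos v)"
  by (simp add: lift_def)

lemma lift_near: "\<exists>t. lift v t \<and> \<bar>s - t\<bar> \<le> 1 / 2"
proof -
  have "\<bar>(s - pos v) - of_int (round (s - pos v))\<bar> \<le> 1 / 2"
    using of_int_round_abs_le[of "s - pos v"] by (simp add: abs_minus_commute)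
  then show ?thesis
    by (intro exI[of _ "pos v + of_int (round (s - pos v))"]) (simp add: lift_def algebra_simps)
qed

text \<open>Every vertex has a lift in each unit interval, so depth 0 is one box repeated over the
  whole cover. This is what makes loops around the origin contractible.\<close>

lemma inbox_root: "inbox p (0, k) \<longleftrightarrow> p \<in> V \<and> dep p = 0"
proof -
  have "lift p (pos p + of_int (k - \<lfloor>pos p\<rfloor>))" "\<lfloor>pos p + of_int (k - \<lfloor>pos p\<rfloor>)\<rfloor> = k"
    by (auto simp: lift_def)
  then show ?thesis
    by (auto simp: inbox_def col_def)
qed

end

text \<open>The relation \<open>adj\<close> is reflexive, so that \<open>adj ^^ n\<close> relates vertices at distance at most \<open>n\<close>. The
  assumption \<open>ray\<close> says that an edge \<open>u, w\<close> is accompanied by every vertex in the boxes above \<open>w\<close>, up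
  to 12 levels above \<open>u\<close>; \<open>near\<close> says that this is high enough for the columns of \<open>u\<close> and \<open>w\<close> to meet.\<close>

locale box_graph_adj = box_graph V adj dep pos l
  for V :: "'v set" and adj dep pos l +
  assumes adj_sub: "adj \<subseteq> V \<times> V"
    and adj_refl: "v \<in> V \<Longrightarrow> (v, v) \<in> adj"
    and adj_sym: "(v, w) \<in> adj \<Longrightarrow> (w, v) \<in> adj"
    and box_clique: "\<lbrakk>inbox v b; inbox w c; boxadj b c; fst b \<le> l; fst c \<le> l\<rbrakk> \<Longrightarrow> (v, w) \<in> adj"
    and ray: "\<lbrakk>(u, w) \<in> adj; lift u s; lift w t; \<bar>s - t\<bar> \<le> 1 / 2; j \<le> l; dep u \<le> j + 12;
       \<bar>k - col j t\<bar> \<le> 1; inbox p (j, k)\<rbrakk> \<Longrightarrow> (p, u) \<in> adj \<or> (p, w) \<in> adj"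
    and near: "\<lbrakk>(u, w) \<in> adj; lift u s; lift w t; \<bar>s - t\<bar> \<le> 1 / 2; dep u \<le> dep w\<rbrakk>
       \<Longrightarrow> \<bar>col (dep u - 12) s - col (dep u - 12) t\<bar> \<le> 1"
    and cross: "\<lbrakk>(u, w) \<in> adj; lift u s; lift w t; lift p x; p \<in> V; dep p \<le> l; l < dep u; l < dep w;
       s \<le> x; x \<le> t; t - s \<le> 1 / 2\<rbrakk> \<Longrightarrow> (u, p) \<in> adj \<and> (p, w) \<in> adj"

text \<open>The aim of this locale is that a colouring which is constant around each vertex near the rays of
  \<open>u\<close> and \<open>v\<close> and near the holes that these rays meet cannot separate \<open>u\<close> from \<open>v\<close> within a component.\<close>

locale coloured_box_graph = box_graph_adj V adj dep pos l
  for V :: "'v set" and adj dep pos l +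
  fixes u v :: 'v and \<tau> :: "'v \<Rightarrow> bool"
  assumes uV: "u \<in> V" and vV: "v \<in> V"
    and stable: "\<lbrakk>w \<in> touched u v; (w, x) \<in> adj; (x, y) \<in> adj; (y, z) \<in> adj\<rbrakk> \<Longrightarrow> \<tau> z = \<tau> w"
begin

abbreviation "W \<equiv> holes u v"

text \<open>By the existential, an empty box counts as False. Near the explored boxes
  \<open>tb_eq\<close> shows that all vertices of a box agree.\<close>

definition tb :: "box \<Rightarrow> bool" where
  "tb b \<longleftrightarrow> (\<exists>p. inbox p b \<and> \<tau> p)"

lemma stable1: "w \<in> touched u v \<Longrightarrow> (w, x) \<in> adj \<Longrightarrow> \<tau> x = \<tau> w"
  using stable adj_refl adj_sub by (meson mem_Sigma_iff subsetD)

lemma stable2: "w \<in> touched u v \<Longrightarrow> (w, x) \<in> adj \<Longrightarrow> (x, y) \<in> adj \<Longrightarrow> \<tau> y = \<tau> w"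
  using stable adj_refl adj_sub by (meson mem_Sigma_iff subsetD)

lemma touchedI:
  assumes "inbox p b" "fst b \<le> l" "c \<in> rays u v \<union> W" "boxadj b c"
  shows "p \<in> touched u v"
proof -
  obtain t where t: "p \<in> V" "dep p = fst b" "lift p t" "col (fst b) t = snd b"
    using assms(1) by (auto simp: inbox_def)
  then have "boxadj (min (dep p) l, col (min (dep p) l) t) c"
    using assms(2,4) by (simp add: min_absorb1)
  with t assms(3) show ?thesis
    unfolding touched_def by blast
qed

lemma tb_eq:
  assumes "inbox p b" "fst b \<le> l" "c \<in> rays u v \<union> W" "boxadj b c"
  shows "tb b = \<tau> p"
proof -
  have "\<tau> q = \<tau> p" if "inbox q b" for q
    using stable1[OF touchedI[OF assms], of q] box_clique[OF assms(1) that] assms(2) by simp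
  with assms(1) show ?thesis
    unfolding tb_def by blast
qed

lemma tb_adj:
  assumes "active b" "active b'" "boxadj b b'" "fst b \<le> l" "fst b' \<le> l"
    and "c \<in> rays u v \<union> W" "boxadj b c" "c' \<in> rays u v \<union> W" "boxadj b' c'"
  shows "tb b = tb b'"
proof -
  from assms(1,2) obtain p p' where p: "inbox p b" "inbox p' b'"
    by (auto simp: active_def)
  have "\<tau> p' = \<tau> p"
    using stable1[OF touchedI[OF p(1) assms(4,6,7)], of p'] box_clique[OF p assms(3-5)] by simp
  with p assms show ?thesis
    using tb_eq by simp
qed

lemma tb_inactive: "\<not> active b \<Longrightarrow> \<not> tb b"
  by (auto simp: tb_def active_def)

lemma hole_boundary: "b \<in> W \<Longrightarrow> c \<notin> W \<Longrightarrow> boxadj b c \<Longrightarrow> fst c \<le> l \<Longrightarrow> active c"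
  using holes.step by blast

text \<open>The jump across the boundary of the holes: a cocycle with values in \<open>\<int>/2\<close>.\<close>

definition jump :: "box \<Rightarrow> box \<Rightarrow> bool" where
  "jump b c \<longleftrightarrow> (b \<in> W \<and> c \<notin> W \<and> tb c) \<or> (c \<in> W \<and> b \<notin> W \<and> tb b)"

lemma jump_sym: "jump b c = jump c b"
  by (auto simp: jump_def)

text \<open>With exactly one corner in a hole, the other two are active neighbours of equal colour
  and their jumps cancel. With two corners in holes, both see the colour of the third. Otherwise
  nothing jumps.\<close>

lemma jump_triangle:
  assumes "boxadj a b" "boxadj b c" "boxadj a c" "fst a \<le> l" "fst b \<le> l" "fst c \<le> l"
  shows "jump a c = (jump a b \<noteq> jump b c)"
proof -
  have *: "tb y = tb z" if "x \<in> W" "y \<notin> W" "z \<notin> W" "boxadj x y" "boxadj x z" "boxadj y z"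
    "fst y \<le> l" "fst z \<le> l" for x y z
    using that hole_boundary by (intro tb_adj[of y z x x]) (auto intro: boxadj_sym)
  note s = assms(1-3)[THEN boxadj_sym]
  show ?thesis
    using *[of a b c] *[of b a c] *[of c a b] assms s unfolding jump_def by blast
qed

text \<open>As the box complex is simply connected, the cocycle is a coboundary. Its potential is defined by
  summing up along the tree of boxes.\<close>

primrec psi :: "nat \<Rightarrow> int \<Rightarrow> bool" where
  "psi 0 k = False"
| "psi (Suc d) k = (psi d (k div 2) \<noteq> jump (Suc d, k) (d, k div 2))"

text \<open>This gives the start of \<open>psi_row\<close>: the root row carries no jump at
  all.\<close>

lemma root_hole: "(0, k) \<in> W \<Longrightarrow> (0, k') \<in> W"
proof -
  assume W: "(0, k) \<in> W"
  have in0: "\<not> active (0, j)" for j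
    using holesD[OF W] by (auto simp: active_def inbox_root)
  have ray0: "(0, j) \<in> rays u v" for j
  proof -
    have "lift u (pos u + of_int (j - \<lfloor>pos u\<rfloor>))" "col 0 (pos u + of_int (j - \<lfloor>pos u\<rfloor>)) = j"
      by (auto simp: lift_def col_def)
    then show ?thesis
      by (auto simp: rays_def intro!: exI[of _ "pos u + of_int (j - \<lfloor>pos u\<rfloor>)"])
  qed
  show ?thesis
    by (intro holes.start ray0 in0)
qed

text \<open>Two neighbours and their parents span a square filled by two triangles, so the claim
  moves up one level at a time until the root row, where the loop closes.\<close>

lemma psi_row: "d \<le> l \<Longrightarrow> \<bar>k - k'\<bar> \<le> 1 \<Longrightarrow> (psi d k \<noteq> psi d k') = jump (d, k) (d, k')"
proof (induction d arbitrary: k k')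
  case 0
  then show ?case
    using root_hole by (auto simp: jump_def)
next
  case (Suc d)
  define m m' where "m = k div 2" and "m' = k' div 2"
  have mm: "\<bar>m - m'\<bar> \<le> 1"
    unfolding m_def m'_def using Suc.prems near_div by simp
  have 1: "jump (Suc d, k) (Suc d, k') = (jump (Suc d, k) (d, m) \<noteq> jump (d, m) (Suc d, k'))"
    using Suc.prems mm by (intro jump_triangle) (auto simp: boxadj_def m_def m'_def)
  have 2: "jump (d, m) (Suc d, k') = (jump (d, m) (d, m') \<noteq> jump (d, m') (Suc d, k'))"
    using Suc.prems mm by (intro jump_triangle) (auto simp: boxadj_def m_def m'_def)
  have 3: "(psi d m \<noteq> psi d m') = jump (d, m) (d, m')"
    using Suc.IH mm Suc.prems by simp
  show ?case
    using 1 2 3 jump_sym[of "(d, m')" "(Suc d, k')"] by (auto simp: m_def m'_def)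
qed

lemma psi_cross: "Suc d \<le> l \<Longrightarrow> \<bar>k div 2 - k'\<bar> \<le> 1 \<Longrightarrow> (psi (Suc d) k \<noteq> psi d k') = jump (Suc d, k) (d, k')"
proof -
  assume a: "Suc d \<le> l" "\<bar>k div 2 - k'\<bar> \<le> 1"
  have 1: "jump (Suc d, k) (d, k') = (jump (Suc d, k) (d, k div 2) \<noteq> jump (d, k div 2) (d, k'))"
    using a by (intro jump_triangle) (auto simp: boxadj_def)
  show ?thesis
    using 1 psi_row[of d "k div 2" k'] a by auto
qed

lemma psi_jump:
  assumes "boxadj b c" "fst b \<le> l" "fst c \<le> l"
  shows "(psi (fst b) (snd b) \<noteq> psi (fst c) (snd c)) = jump b c"
proof -
  obtain i k j m where bc: "b = (i, k)" "c = (j, m)"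
    by (cases b; cases c)
  from assms(1) consider "i = j" "\<bar>k - m\<bar> \<le> 1" | "i = Suc j" "\<bar>k div 2 - m\<bar> \<le> 1"
    | "j = Suc i" "\<bar>m div 2 - k\<bar> \<le> 1"
    by (auto simp: boxadj_def bc)
  then show ?thesis
  proof cases
    case 1
    then show ?thesis using psi_row assms bc by simp
  next
    case 2
    then show ?thesis using psi_cross[of j k m] assms bc by simp
  next
    case 3
    then show ?thesis using psi_cross[of i m k] assms bc jump_sym[of b c] by (simp del: psi.simps) blast
  qed
qed

text \<open>Leaving a hole changes \<open>psi\<close> by the colour of the active box that is
  entered. Shifting \<open>psi\<close> by \<open>x\<close> inside holes therefore makes the
  potential constant across every piece of boundary of colour \<open>x\<close>.\<close>

definition pot :: "bool \<Rightarrow> box \<Rightarrow> bool" where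
  "pot x b = (psi (fst b) (snd b) \<noteq> (b \<in> W \<and> x))"

text \<open>Two edges are allowed because \<open>ray\<close> offers adjacency to only one of the two
  ends of an edge; the other end is one edge further away.\<close>

definition good :: "'v \<Rightarrow> box \<Rightarrow> bool" where
  "good y b \<longleftrightarrow> fst b \<le> l \<and> (active b \<longrightarrow> (\<exists>p q. inbox p b \<and> (p, q) \<in> adj \<and> (q, y) \<in> adj))"

lemma pot_eq:
  assumes "good y b" "good y c" "boxadj b c"
  shows "pot (\<tau> y) b = pot (\<tau> y) c"
proof -
  have *: "tb b' = \<tau> y" if "c' \<in> W" "b' \<notin> W" "good y b'" "boxadj b' c'" for b' c'
  proof -
    have "active b'"
      using hole_boundary[OF that(1,2)] that(3,4) by (auto simp: good_def intro: boxadj_sym)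
    with that(3) obtain p q where p: "inbox p b'" "(p, q) \<in> adj" "(q, y) \<in> adj" "fst b' \<le> l"
      by (auto simp: good_def)
    then show ?thesis
      using tb_eq[of p b' c'] stable2[OF touchedI[of p b' c'] p(2,3)] that by auto
  qed
  show ?thesis
    using psi_jump[OF assms(3)] assms *[of b c] *[of c b] boxadj_sym[OF assms(3)]
    unfolding pot_def jump_def good_def by blast
qed

lemma pot_chain:
  "(\<And>i. i \<le> m \<Longrightarrow> good y (j + i, k div 2 ^ (m - i))) \<Longrightarrow> pot (\<tau> y) (j + m, k) = pot (\<tau> y) (j, k div 2 ^ m)"
proof (induction m arbitrary: k)
  case (Suc m)
  have "good y (j + i, k div 2 div 2 ^ (m - i))" if "i \<le> m" for i
    using Suc.prems[of i] that by (simp add: Suc_diff_le zdiv_zmult2_eq)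
  then have "pot (\<tau> y) (j + m, k div 2) = pot (\<tau> y) (j, k div 2 div 2 ^ m)"
    by (rule Suc.IH)
  moreover have "pot (\<tau> y) (j + Suc m, k) = pot (\<tau> y) (j + m, k div 2)"
    using Suc.prems[of "Suc m"] Suc.prems[of m] by (intro pot_eq) (auto simp: boxadj_def)
  ultimately show ?case
    by (simp add: zdiv_zmult2_eq)
qed simp

section \<open>Transport of the potential along edges and below the boxes\<close>

definition rp :: "int \<Rightarrow> real" where
  "rp k = (SOME s. \<exists>p. inbox p (l, k) \<and> lift p s \<and> col l s = k)"

lemma rp: "active (l, k) \<Longrightarrow> \<exists>p. inbox p (l, k) \<and> lift p (rp k) \<and> col l (rp k) = k"
  unfolding rp_def by (rule someI_ex) (auto simp: active_def inbox_def)

text \<open>A vertex below the boxes is attached to the nearest base box on its side of the base points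
  \<open>rp k\<close>, since a path along the bottom cannot pass such a point without being adjacent to it.\<close>

definition attach :: "'v \<Rightarrow> real \<Rightarrow> box" where
  "attach w t = (if dep w \<le> l then (dep w, col (dep w) t)
     else let k = col l t in (l, if active (l, k) then if t < rp k then k - 1 else k + 1 else k))"

lemma attach_near: "\<exists>k. attach w t = (min (dep w) l, k) \<and> \<bar>k - col (min (dep w) l) t\<bar> \<le> 1"
  by (auto simp: attach_def Let_def min_def)

text \<open>The potential corrected by the colour inside the holes; it is constant along edges of the graph,
  while \<open>kap\<close> below is constant along the rays.\<close>

definition phi :: "'v \<Rightarrow> real \<Rightarrow> bool" where
  "phi w t = pot (\<tau> w) (attach w t)"

lemma attach_touched:
  assumes "w \<in> V" "lift w t" "attach w t \<in> rays u v \<union> W"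
  shows "w \<in> touched u v"
proof -
  obtain k where "attach w t = (min (dep w) l, k)" "\<bar>k - col (min (dep w) l) t\<bar> \<le> 1"
    using attach_near by blast
  then have "boxadj (min (dep w) l, col (min (dep w) l) t) (attach w t)"
    by (auto simp: boxadj_def)
  with assms show ?thesis
    unfolding touched_def by blast
qed

text \<open>The edge is replaced by a detour through boxes: up from \<open>w\<close>, sideways by
  \<open>near\<close>, down the columns above \<open>x\<close>. By \<open>ray\<close> every box on
  it is good for \<open>w\<close>, so \<open>pot (\<tau> w)\<close> does not change.\<close>

lemma phi_edge_high:
  assumes e: "(w, x) \<in> adj" "lift w s" "lift x t" "\<bar>s - t\<bar> \<le> 1 / 2" "dep w \<le> dep x" "dep w \<le> l"
  shows "phi w s = phi x t"
proof -
  have V: "w \<in> V" "x \<in> V"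
    using e adj_sub by auto
  \<comment> \<open>Truncated subtraction: within 12 levels of the top the detour runs through the
    root row.\<close>
  define j where "j = dep w - 12"
  have goodx: "good w (i, k)" if "i \<le> l" "j \<le> i" "\<bar>k - col i t\<bar> \<le> 1" for i k
  proof -
    have "(p, w) \<in> adj \<or> (p, x) \<in> adj" if "inbox p (i, k)" for p
      using ray[of w x s t i k p] e \<open>i \<le> l\<close> \<open>j \<le> i\<close> \<open>\<bar>k - col i t\<bar> \<le> 1\<close> that by (simp add: j_def)
    with that(1) show ?thesis
      unfolding good_def active_def using e(1) adj_sym adj_refl V by (metis fst_conv)
  qed
  have goodw: "good w (i, k)" if "i \<le> l" "j \<le> i" "\<bar>k - col i s\<bar> \<le> 1" for i k
  proof -
    have "(p, w) \<in> adj" if "inbox p (i, k)" for p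
      using ray[of w w s s i k p] e \<open>i \<le> l\<close> \<open>j \<le> i\<close> \<open>\<bar>k - col i s\<bar> \<le> 1\<close> that V adj_refl
      by (simp add: j_def)
    with that(1) show ?thesis
      unfolding good_def active_def using adj_refl V by (metis fst_conv)
  qed
  define m where "m = dep w - j"
  have mw: "dep w = j + m"
    by (simp add: m_def j_def)
  have "pot (\<tau> w) (j + m, col (j + m) s) = pot (\<tau> w) (j, col (j + m) s div 2 ^ m)"
  proof (rule pot_chain)
    fix i assume i: "i \<le> m"
    have "col (j + m) s div 2 ^ (m - i) = col (j + i) s"
      using col_add_div[of "j + i" "m - i" s] i by simp
    then show "good w (j + i, col (j + m) s div 2 ^ (m - i))"
      using goodw[of "j + i"] i mw e(6) by simp
  qed
  then have 1: "phi w s = pot (\<tau> w) (j, col j s)"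
    using e(6) by (simp add: phi_def attach_def mw col_add_div)
  obtain k where k: "attach x t = (min (dep x) l, k)" "\<bar>k - col (min (dep x) l) t\<bar> \<le> 1"
    using attach_near by blast
  define n where "n = min (dep x) l - j"
  have nx: "min (dep x) l = j + n"
    using e(5,6) by (simp add: n_def j_def)
  \<comment> \<open>The box to which \<open>x\<close> is attached may be one column off, and passing
    to ancestors keeps it within one column.\<close>
  have nd: "\<bar>k div 2 ^ (n - i) - col (j + i) t\<bar> \<le> 1" if "i \<le> n" for i
    using near_div[OF k(2), of "2 ^ (n - i)"] col_add_div[of "j + i" "n - i" t] that nx by simp
  have "pot (\<tau> w) (j + n, k) = pot (\<tau> w) (j, k div 2 ^ n)"
  proof (rule pot_chain)
    fix i assume i: "i \<le> n"
    then show "good w (j + i, k div 2 ^ (n - i))"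
      using goodx[of "j + i"] nd nx by simp
  qed
  also have "\<dots> = pot (\<tau> w) (j, col j t)"
  proof (rule pot_eq)
    show "good w (j, k div 2 ^ n)" "good w (j, col j t)"
      using nd[of 0] nx by (auto intro!: goodx)
    show "boxadj (j, k div 2 ^ n) (j, col j t)"
      using nd[of 0] by (simp add: boxadj_def)
  qed
  also have "\<dots> = pot (\<tau> w) (j, col j s)"
  proof (rule pot_eq)
    show "good w (j, col j t)"
      using nx by (intro goodx) auto
    show "good w (j, col j s)"
      using nx by (intro goodw) auto
    show "boxadj (j, col j t) (j, col j s)"
    proof -
      have "\<bar>col j s - col j t\<bar> \<le> 1"
        using near[OF e(1-5)] by (simp only: j_def)
      then show ?thesis
        by (simp add: boxadj_def abs_le_iff)
    qed
  qed
  finally have 2: "pot (\<tau> w) (attach x t) = phi w s"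
    using 1 k(1) nx by simp
  \<comment> \<open>\<open>phi\<close> at \<open>x\<close> uses the colour of \<open>x\<close>. This
    makes a difference only if \<open>x\<close> is attached to a hole, and then \<open>x\<close> is
    touched.\<close>
  have "\<tau> w = \<tau> x" if "attach x t \<in> W"
    using stable1[OF attach_touched[of x t]] that V e adj_sym by blast
  with 2 show ?thesis
    unfolding phi_def[of x] pot_def by blast
qed

lemma pot_run:
  assumes "\<And>i. k \<le> i \<Longrightarrow> i \<le> k + int n \<Longrightarrow> \<not> active (l, i)"
  shows "((l, k) \<in> W \<longleftrightarrow> (l, k + int n) \<in> W) \<and> psi l k = psi l (k + int n)"
  using assms
proof (induction n)
  case (Suc n)
  then have IH: "((l, k) \<in> W \<longleftrightarrow> (l, k + int n) \<in> W) \<and> psi l k = psi l (k + int n)"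
    by simp
  have na: "\<not> active (l, k + int n)" "\<not> active (l, k + int (Suc n))"
    using Suc.prems by simp_all
  have "boxadj (l, k + int n) (l, k + int (Suc n))"
    by (simp add: boxadj_def)
  then have "(l, k + int n) \<in> W \<longleftrightarrow> (l, k + int (Suc n)) \<in> W"
    using na holes.step boxadj_sym by (metis fst_conv order_refl)
  moreover have "psi l (k + int n) = psi l (k + int (Suc n))"
    using psi_row[of l "k + int n" "k + int (Suc n)"] na tb_inactive by (auto simp: jump_def)
  ultimately show ?case
    using IH by simp
qed simp

text \<open>If a base point lies between the ends, its vertex is adjacent to both and splits the
  edge into two with an end at depth \<open>l\<close>. Otherwise no column strictly between is
  active, and the attached boxes coincide, bound a run of empty boxes, or are two active
  neighbours.\<close>

lemma phi_edge_low:
  assumes e: "(w, x) \<in> adj" "lift w s" "lift x t" "s \<le> t" "t - s \<le> 1 / 2" "l < dep w" "l < dep x"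
  shows "phi w s = phi x t"
proof -
  have V: "w \<in> V" "x \<in> V"
    using e adj_sub by auto
  show ?thesis
  proof (cases "\<exists>k. active (l, k) \<and> s \<le> rp k \<and> rp k \<le> t")
    case True
    then obtain k where k: "active (l, k)" "s \<le> rp k" "rp k \<le> t"
      by blast
    from rp[OF k(1)] obtain p where p: "inbox p (l, k)" "lift p (rp k)"
      by blast
    have pV: "p \<in> V" "dep p = l"
      using p by (auto simp: inbox_def)
    have "(w, p) \<in> adj \<and> (p, x) \<in> adj"
      using cross[of w x s t p "rp k"] e k p pV by simp
    then show ?thesis
      using phi_edge_high[of p w "rp k" s] phi_edge_high[of p x "rp k" t] e k p pV adj_sym by auto
  next
    case False
    define k k' where "k = col l s" and "k' = col l t"
    have kk: "k \<le> k'"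
      unfolding k_def k'_def using e(4) col_mono by blast
    have mid: "\<not> active (l, i)" if "k < i" "i < k'" for i
    proof
      assume a: "active (l, i)"
      with rp have "col l (rp i) = i" by blast
      then have "s < rp i" "rp i < t"
        using that by (auto simp: k_def k'_def intro: col_less_imp_less[of l])
      with False a show False by (metis less_imp_le)
    qed
    have rpk: "rp k < s" if "active (l, k)" "k < k'"
    proof (rule ccontr)
      assume "\<not> rp k < s"
      moreover have "rp k < t"
        using rp[OF that(1)] that(2) by (auto simp: k'_def intro: col_less_imp_less[of l])
      ultimately show False
        using False that by (metis less_imp_le not_le)
    qed
    have rpk': "t < rp k'" if "active (l, k')" "k < k'"
    proof (rule ccontr)
      assume "\<not> t < rp k'"
      moreover have "s < rp k'"
        using rp[OF that(1)] that(2) by (auto simp: k_def intro: col_less_imp_less[of l])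
      ultimately show False
        using False that by (metis less_imp_le not_le)
    qed
    define a a' where "a = snd (attach w s)" and "a' = snd (attach x t)"
    have att: "attach w s = (l, a)" "attach x t = (l, a')"
      using e by (simp_all add: attach_def Let_def a_def a'_def)
    have ww: "\<tau> w = \<tau> x" if "(l, a) \<in> W \<or> (l, a') \<in> W"
      using stable1[OF attach_touched[of w s]] stable1[OF attach_touched[of x t]] that V e adj_sym att
      by (metis UnI2)
    have a_eq: "a = (if active (l, k) then if s < rp k then k - 1 else k + 1 else k)"
      "a' = (if active (l, k') then if t < rp k' then k' - 1 else k' + 1 else k')"
      using e by (simp_all add: attach_def Let_def a_def a'_def k_def k'_def)
    have "((l, a) \<in> W \<longleftrightarrow> (l, a') \<in> W) \<and> psi l a = psi l a'"
    proof (cases "k = k'")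
      case True
      then have "a = a'"
        using False e(4) unfolding a_eq by (smt (verit))
      then show ?thesis by simp
    next
      case f: False
      with kk have lt: "k < k'" by simp
      have a1: "a = (if active (l, k) then k + 1 else k)" "a' = (if active (l, k') then k' - 1 else k')"
        using rpk rpk' lt by (auto simp: a_eq)
      show ?thesis
      proof (cases "a \<le> a'")
        case True
        have "\<not> active (l, i)" if "a \<le> i" "i \<le> a'" for i
          using mid[of i] that lt by (cases "i = k"; cases "i = k'") (auto simp: a1 split: if_splits)
        then show ?thesis
          using pot_run[of a "nat (a' - a)"] True by simp
      next
        case False
        \<comment> \<open>What remains is \<open>k' = k + 1\<close> with both boxes active: each end
          is attached to the box above the other.\<close>
        then have "active (l, k)" "active (l, k')" "a = k'" "a' = k"
          using lt by (auto simp: a1 split: if_splits)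
        moreover from this have "psi l k = psi l k'"
          using psi_row[of l k k'] False lt a1 holesD by (auto simp: jump_def)
        ultimately show ?thesis
          using holesD by auto
      qed
    qed
    with ww show ?thesis
      by (auto simp: phi_def att pot_def)
  qed
qed

lemma phi_edge:
  assumes e: "(w, x) \<in> adj" "lift w s" "lift x t" "\<bar>s - t\<bar> \<le> 1 / 2"
  shows "phi w s = phi x t"
proof -
  have e': "(x, w) \<in> adj" "\<bar>t - s\<bar> \<le> 1 / 2"
    using e(4) adj_sym[OF e(1)] by (simp_all add: abs_minus_commute)
  consider "dep w \<le> l" "dep w \<le> dep x" | "dep x \<le> l" "dep x \<le> dep w" | "l < dep w" "l < dep x"
    by linarith
  then show ?thesis
  proof cases
    case 1
    then show ?thesis using phi_edge_high e by blast
  next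
    case 2
    then show ?thesis using phi_edge_high[of x w t s] e e' by simp
  next
    case 3
    then show ?thesis
      using phi_edge_low[of w x s t] phi_edge_low[of x w t s] e e' by (cases "s \<le> t") auto
  qed
qed

text \<open>The path is followed on the universal cover. The lift it ends at depends on the winding
  of the path, which is harmless as \<open>phi_kap\<close> holds for every lift.\<close>

lemma phi_reach: "(w, x) \<in> adj\<^sup>* \<Longrightarrow> lift w s \<Longrightarrow> \<exists>t. lift x t \<and> phi x t = phi w s"
proof (induction rule: rtrancl_induct)
  case (step y z)
  then obtain t where t: "lift y t" "phi y t = phi w s" by blast
  obtain t' where "lift z t'" "\<bar>t - t'\<bar> \<le> 1 / 2"
    using lift_near by blast
  then show ?case
    using phi_edge[OF step(2) t(1)] t(2) by metis
qed auto

section \<open>Transport along the rays and the contradiction\<close>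

definition kap :: "box \<Rightarrow> bool" where
  "kap b = (psi (fst b) (snd b) \<noteq> tb b)"

text \<open>On a ray the boxes in holes are exactly the inactive ones. So the jump between
  neighbours is the change of \<open>tb\<close>, and the two cancel.\<close>

lemma kap_adj:
  assumes "b \<in> rays u v" "c \<in> rays u v" "boxadj b c"
  shows "kap b = kap c"
proof -
  have d: "fst b \<le> l" "fst c \<le> l"
    using assms by (auto simp: rays_def)
  have W: "b \<in> W \<longleftrightarrow> \<not> active b" "c \<in> W \<longleftrightarrow> \<not> active c"
    using assms holes.start holesD by blast+
  have "tb b = tb c" if "active b" "active c"
    using that assms d by (intro tb_adj[of b c b c]) auto
  then show ?thesis
    using psi_jump[OF assms(3) d] W tb_inactive[of b] tb_inactive[of c] unfolding kap_def jump_def by blast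
qed

lemma kap_root: "kap (0, k) = kap (0, k')"
  by (simp add: kap_def tb_def inbox_root)

lemma kap_rays:
  assumes "b \<in> rays u v"
  shows "kap b = kap (0, 0)"
proof -
  obtain w t where w: "w \<in> {u, v}" "lift w t" "\<bar>snd b - col (fst b) t\<bar> \<le> 1" "fst b \<le> l"
    using assms by (auto simp: rays_def)
  have r: "(j, col j t) \<in> rays u v" if "j \<le> l" for j
    using w that by (auto simp: rays_def intro: exI[of _ t])
  have "j \<le> l \<Longrightarrow> kap (j, col j t) = kap (0, 0)" for j
  proof (induction j)
    case 0
    then show ?case using kap_root by simp
  next
    case (Suc j)
    have "kap (Suc j, col (Suc j) t) = kap (j, col j t)"
      using Suc.prems by (intro kap_adj r) (auto simp: boxadj_def col_Suc_div)
    with Suc show ?case by simp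
  qed
  moreover have "kap b = kap (fst b, col (fst b) t)"
    using w assms r by (intro kap_adj) (auto simp: boxadj_def)
  ultimately show ?thesis
    using w by simp
qed

lemma attach_ray: "w \<in> {u, v} \<Longrightarrow> lift w t \<Longrightarrow> attach w t \<in> rays u v"
  using attach_near[of w t] by (force simp: rays_def)

text \<open>A path that starts below two adjacent active boxes, between their base points, either stays there
  or meets one of the two cliques.\<close>

lemma trapped:
  assumes w: "w \<in> {u, v}" "lift w s" "l < dep w" and act: "active (attach w s)"
    and reach: "(w, x) \<in> adj\<^sup>*" and ne: "\<tau> x \<noteq> \<tau> w"
  shows "tb (attach w s) = \<tau> w"
proof (rule ccontr)
  assume neq: "tb (attach w s) \<noteq> \<tau> w"
  have wV: "w \<in> V"
    using w uV vV by auto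
  define a where "a = snd (attach w s)"
  have a: "attach w s = (l, a)"
    using w by (simp add: attach_def Let_def a_def)
  define k where "k = col l s"
  have ak: "a = (if active (l, k) then if s < rp k then k - 1 else k + 1 else k)"
    using w by (simp add: attach_def Let_def a_def k_def)
  \<comment> \<open>Only an active box diverts the attachment to its neighbour, so the box above
    \<open>w\<close> and the attached box are both active.\<close>
  have actk: "active (l, k)"
    using act ak unfolding a by (auto split: if_splits)
  obtain k1 where k1: "active (l, k1)" "active (l, k1 + 1)" "a \<in> {k1, k1 + 1}" "rp k1 \<le> s" "s \<le> rp (k1 + 1)"
  proof (cases "s < rp k")
    case True
    then have "a = k - 1" using ak actk by simp
    moreover from this have "col l (rp (k - 1)) = k - 1"
      using rp[of "k - 1"] act a by auto
    then have "rp (k - 1) \<le> s"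
      by (intro less_imp_le col_less_imp_less[of l]) (simp add: k_def)
    ultimately show ?thesis
      using that[of "k - 1"] actk act a True by simp
  next
    case False
    then have "a = k + 1" using ak actk by simp
    moreover from this have "col l (rp (k + 1)) = k + 1"
      using rp[of "k + 1"] act a by auto
    then have "s \<le> rp (k + 1)"
      by (intro less_imp_le col_less_imp_less[of l]) (simp add: k_def)
    ultimately show ?thesis
      using that[of k] actk act a False by simp
  qed
  have ar: "(l, a) \<in> rays u v"
    using attach_ray[OF w(1,2)] a by simp
  have tbk: "tb (l, i) = tb (l, a)" if "i \<in> {k1, k1 + 1}" for i
    using that k1 ar by (intro tb_adj[of _ _ "(l, a)" "(l, a)"]) (auto simp: boxadj_def)
  have taup: "\<tau> p = tb (l, a)" if "i \<in> {k1, k1 + 1}" "inbox p (l, i)" for p i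
    using tb_eq[OF that(2), of "(l, a)"] ar that(1) tbk[OF that(1)] k1(3) by (auto simp: boxadj_def)
  have "\<exists>t. lift x t \<and> l < dep x \<and> rp k1 \<le> t \<and> t \<le> rp (k1 + 1) \<and> \<tau> x = \<tau> w"
    using reach
  proof (induction rule: rtrancl_induct)
    case base
    then show ?case using w k1 by blast
  next
    case (step y z)
    then obtain t where t: "lift y t" "l < dep y" "rp k1 \<le> t" "t \<le> rp (k1 + 1)" "\<tau> y = \<tau> w"
      by blast
    obtain p1 p2 where p: "inbox p1 (l, k1)" "lift p1 (rp k1)" "col l (rp k1) = k1"
      "inbox p2 (l, k1 + 1)" "lift p2 (rp (k1 + 1))" "col l (rp (k1 + 1)) = k1 + 1"
      using rp k1(1,2) by meson
    have pV: "p1 \<in> V" "dep p1 = l" "p2 \<in> V" "dep p2 = l"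
      using p by (auto simp: inbox_def)
    have yz: "(z, y) \<in> adj" "y \<in> V" "z \<in> V"
      using step(2) adj_sym adj_sub by auto
    have ct: "col l t \<in> {k1, k1 + 1}"
      using col_mono[OF t(3), of l] col_mono[OF t(4), of l] p by auto
    have "boxadj (min (dep y) l, col (min (dep y) l) t) (l, a)"
      using k1(3) ct t(2) by (auto simp: boxadj_def min_absorb2)
    then have ytouched: "y \<in> touched u v"
      unfolding touched_def using t(1) yz ar by blast
    have zy: "\<tau> z = \<tau> w"
      using stable1[OF ytouched step(2)] t(5) by simp
    have noadj: "(y, q) \<notin> adj" "(z, q) \<notin> adj" if "i \<in> {k1, k1 + 1}" "inbox q (l, i)" for q i
      using stable1[OF ytouched] stable2[OF ytouched step(2)] taup[OF that] neq a t(5) by auto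
    obtain t' where t': "lift z t'" "\<bar>t' - t\<bar> \<le> 1 / 2"
      using lift_near by (metis abs_minus_commute)
    have "l < dep z"
    proof (rule ccontr)
      assume "\<not> l < dep z"
      then have "(p1, z) \<in> adj \<or> (p1, y) \<in> adj"
        using ray[of z y t' t l k1 p1] yz t t' p ct by auto
      then show False
        using noadj[of k1 p1] p adj_sym by blast
    qed
    moreover have "rp k1 \<le> t'"
    proof (rule ccontr)
      assume "\<not> rp k1 \<le> t'"
      then have "(p1, y) \<in> adj"
        using cross[of z y t' t p1 "rp k1"] \<open>l < dep z\<close> t t' p pV yz by simp
      then show False
        using noadj[of k1 p1] p adj_sym by blast
    qed
    moreover have "t' \<le> rp (k1 + 1)"
    proof (rule ccontr)
      assume "\<not> t' \<le> rp (k1 + 1)"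
      then have "(y, p2) \<in> adj"
        using cross[of y z t t' p2 "rp (k1 + 1)"] \<open>l < dep z\<close> t t' p pV step(2) by simp
      then show False
        using noadj[of "k1 + 1" p2] p by blast
    qed
    ultimately show ?case
      using t' zy by blast
  qed
  with ne show False by blast
qed

text \<open>For an empty attached box, which is in a hole, this is the definition of
  \<open>pot\<close>; for an active one it says that the box has the colour of \<open>w\<close>.
  Below the boxes this comes from \<open>trapped\<close>, hence the vertex \<open>x\<close> of the
  other colour.\<close>

lemma phi_kap:
  assumes w: "w \<in> {u, v}" "lift w s" "(w, x) \<in> adj\<^sup>*" "\<tau> x \<noteq> \<tau> w"
  shows "phi w s = (kap (0, 0) \<noteq> \<tau> w)"
proof -
  have r: "attach w s \<in> rays u v"
    using attach_ray w by blast
  have wV: "w \<in> V"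
    using w uV vV by auto
  have kr: "kap (attach w s) = kap (0, 0)"
    using kap_rays r by blast
  show ?thesis
  proof (cases "active (attach w s)")
    case True
    have "tb (attach w s) = \<tau> w"
    proof (cases "dep w \<le> l")
      case True
      then have "inbox w (attach w s)"
        using w wV by (auto simp: attach_def inbox_def)
      then show ?thesis
        using tb_eq[of w "attach w s" "attach w s"] r True by (simp add: attach_def)
    next
      case False
      then show ?thesis
        using trapped[OF w(1,2) _ True w(3,4)] by simp
    qed
    moreover have "attach w s \<notin> W"
      using True holesD by blast
    ultimately show ?thesis
      using kr by (auto simp: kap_def phi_def pot_def)
  next
    case False
    then have "attach w s \<in> W"
      using r holes.start by blast
    then show ?thesis
      using kr tb_inactive[OF False] by (auto simp: kap_def phi_def pot_def)
  qed
qed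

text \<open>\<open>phi\<close> agrees at \<open>u\<close> and at some lift of \<open>v\<close>,
  while both rays lead to the same value \<open>kap (0, 0)\<close> at the origin, so
  \<open>phi_kap\<close> leaves no room for different colours.\<close>

theorem colour_const:
  assumes "(u, v) \<in> adj\<^sup>*"
  shows "\<tau> u = \<tau> v"
proof (rule ccontr)
  assume ne: "\<tau> u \<noteq> \<tau> v"
  have "sym adj"
    using adj_sym by (auto simp: sym_def)
  then have vu: "(v, u) \<in> adj\<^sup>*"
    using assms by (meson sym_rtrancl symD)
  obtain t where t: "lift v t" "phi v t = phi u (pos u)"
    using phi_reach[OF assms lift_pos] by blast
  show False
    using phi_kap[of u "pos u" v] phi_kap[of v t u] assms vu ne t by auto
qed

end

section \<open>Hyperbolic distances\<close>

text \<open>The angle difference \<open>s\<close> is in full turns, and comparing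
  \<open>cosh\<close> values avoids \<open>arcosh\<close>.\<close>

definition hclose :: "real \<Rightarrow> real \<Rightarrow> real \<Rightarrow> real \<Rightarrow> bool" where
  "hclose R r r' s \<longleftrightarrow> cosh r * cosh r' - sinh r * sinh r' * cos (2 * pi * s) \<le> cosh R"

lemma hclose_sym: "hclose R r r' s \<longleftrightarrow> hclose R r' r s"
  by (simp add: hclose_def mult.commute)

lemma hyp_dist_le_iff:
  assumes "0 \<le> r" "0 \<le> r'" "0 \<le> R"
  shows "hyp_dist (r, \<theta>) (r', \<theta>') \<le> R \<longleftrightarrow> cosh r * cosh r' - sinh r * sinh r' * cos (\<theta> - \<theta>') \<le> cosh R"
  using hyp_dist_nonneg_cosh[OF assms(1,2), of \<theta> \<theta>'] assms(3) by (metis cosh_real_nonneg_le_iff)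

lemma hyp_dist_le_iff_hclose:
  assumes "0 \<le> r" "0 \<le> r'" "0 \<le> R"
    and "s - (pi - \<theta>) / (2 * pi) \<in> \<int>" "t - (pi - \<theta>') / (2 * pi) \<in> \<int>"
  shows "hyp_dist (r, \<theta>) (r', \<theta>') \<le> R \<longleftrightarrow> hclose R r r' (s - t)"
proof -
  obtain m n :: int where mn: "s = (pi - \<theta>) / (2 * pi) + of_int m" "t = (pi - \<theta>') / (2 * pi) + of_int n"
    using assms(4,5) by (auto elim!: Ints_cases simp: diff_eq_eq)
  have "2 * pi * (s - t) = (\<theta>' - \<theta>) + 2 * pi * of_int (m - n)"
    unfolding mn by (simp add: field_simps)
  moreover have "cos ((\<theta>' - \<theta>) + 2 * pi * of_int (m - n)) = cos (\<theta>' - \<theta>)"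
    unfolding cos_add cos_int_2pin sin_int_2pin by simp
  moreover have "cos (\<theta>' - \<theta>) = cos (\<theta> - \<theta>')"
    by (metis cos_minus minus_diff_eq)
  ultimately show ?thesis
    using hyp_dist_le_iff[OF assms(1-3)] by (simp add: hclose_def)
qed

lemma hclose_of_add_le:
  assumes "0 \<le> r" "0 \<le> r'" "r + r' \<le> R"
  shows "hclose R r r' s"
proof -
  have "sinh r * sinh r' * - cos (2 * pi * s) \<le> sinh r * sinh r' * 1"
    using assms by (intro mult_left_mono) (auto simp: minus_le_iff)
  then have "cosh r * cosh r' - sinh r * sinh r' * cos (2 * pi * s) \<le> cosh (r + r')"
    by (simp add: cosh_add)
  also have "\<dots> \<le> cosh R"
    using assms by (simp add: cosh_real_nonneg_le_iff)
  finally show ?thesis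
    by (simp add: hclose_def)
qed

lemma sinh_superadditive:
  fixes x y :: real
  assumes "0 \<le> x" "0 \<le> y"
  shows "sinh x + sinh y \<le> sinh (x + y)"
proof -
  have "sinh x * 1 \<le> sinh x * cosh y" "1 * sinh y \<le> cosh x * sinh y"
    using assms by (intro mult_left_mono mult_right_mono cosh_real_ge_1; simp)+
  then show ?thesis
    by (simp add: sinh_add)
qed

text \<open>On a ray from the origin, \<open>cosh\<close> of the distance is a nonnegative combination of its values at
  the two ends, with the weights of the interpolation identity for \<open>sinh\<close>.\<close>

lemma hclose_mono_radius:
  assumes "hclose R r y s" "0 \<le> x" "x \<le> y" "0 \<le> r" "r \<le> R"
  shows "hclose R r x s"
proof (cases "y = 0")
  case False
  then have y: "0 < y" "0 < sinh y"
    using assms by simp_all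
  let ?f = "\<lambda>x. cosh r * cosh x - sinh r * sinh x * cos (2 * pi * s)"
  have "sinh y * cosh x = sinh (y - x) + sinh x * cosh y"
    by (simp add: sinh_diff algebra_simps)
  then have "sinh y * ?f x = sinh (y - x) * cosh r + sinh x * ?f y"
    by (simp add: algebra_simps)
  also have "\<dots> \<le> sinh (y - x) * cosh R + sinh x * cosh R"
    using assms by (intro add_mono mult_left_mono) (auto simp: hclose_def cosh_real_nonneg_le_iff)
  also have "\<dots> \<le> sinh y * cosh R"
    using sinh_superadditive[of "y - x" x] assms by (simp add: distrib_right[symmetric])
  finally show ?thesis
    using y by (simp add: hclose_def)
qed (use assms in auto)

lemma hclose_mono_angle:
  assumes "hclose R r r' s'" "\<bar>s\<bar> \<le> \<bar>s'\<bar>" "\<bar>s'\<bar> \<le> 1 / 2" "0 \<le> r" "0 \<le> r'"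
  shows "hclose R r r' s"
proof -
  have "cos (2 * pi * \<bar>s'\<bar>) \<le> cos (2 * pi * \<bar>s\<bar>)"
    using assms by (intro cos_monotone_0_pi_le) auto
  moreover have "cos (2 * pi * \<bar>x\<bar>) = cos (2 * pi * x)" for x
    by (cases "x \<ge> 0") auto
  ultimately have "sinh r * sinh r' * cos (2 * pi * s') \<le> sinh r * sinh r' * cos (2 * pi * s)"
    using assms by (intro mult_left_mono) auto
  then show ?thesis
    using assms by (simp add: hclose_def)
qed

lemma hclose_expand: "cosh r * cosh r' - sinh r * sinh r' * cos x
    = cosh (r - r') + sinh r * sinh r' * (1 - cos x)" for r r' x :: real
  by (simp add: cosh_diff algebra_simps)

text \<open>By \<open>hclose_expand\<close>, the \<open>cosh\<close> of the distance has a radial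
  part of at most \<open>exp R / 8\<close> and an angular part of at most \<open>exp R / 5\<close>,
  while \<open>cosh R\<close> is at least \<open>exp R / 2\<close>.\<close>

lemma hcloseI_exp:
  assumes "0 \<le> y" "0 \<le> y'" "\<bar>y - y'\<bar> \<le> R - 3" "s\<^sup>2 * exp (y + y') \<le> exp R / 25"
  shows "hclose R y y' s"
proof -
  have "cosh (y - y') \<le> exp \<bar>y - y'\<bar>"
  proof -
    have "cosh \<bar>y - y'\<bar> \<le> exp \<bar>y - y'\<bar>"
      unfolding cosh_def by (simp add: field_simps)
    then show ?thesis by simp
  qed
  also have "\<dots> \<le> exp R * exp (- 3)"
    using assms by (simp add: exp_add[symmetric])
  also have "exp (- 3 :: real) \<le> 1 / 8"
  proof -
    have "(2::real) ^ 3 \<le> exp 1 ^ 3"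
      using exp_ge_add_one_self[of 1] by (intro power_mono) auto
    then have "(8::real) \<le> exp 3"
      by (simp add: exp_of_nat_mult[symmetric])
    then show ?thesis
      by (simp add: exp_minus field_simps)
  qed
  finally have 1: "cosh (y - y') \<le> exp R / 8"
    by simp
  have pi2: "pi\<^sup>2 \<le> 10"
  proof -
    have "pi \<le> 3.15" using pi_approx by simp
    then have "pi\<^sup>2 \<le> 3.15\<^sup>2" by (intro power_mono) auto
    then show ?thesis by (simp add: power2_eq_square)
  qed
  have "1 - cos (2 * pi * s) = 2 * (sin (pi * s))\<^sup>2"
    using cos_double_sin[of "pi * s"] by (simp add: mult.assoc)
  also have "\<dots> \<le> 2 * (pi * s)\<^sup>2"
    using abs_sin_x_le_abs_x[of "pi * s"] by (simp add: abs_le_square_iff)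
  also have "\<dots> \<le> 20 * s\<^sup>2"
    using mult_right_mono[OF pi2, of "s\<^sup>2"] by (simp add: power_mult_distrib)
  finally have c: "1 - cos (2 * pi * s) \<le> 20 * s\<^sup>2" .
  have "sinh y * sinh y' \<le> exp y / 2 * (exp y' / 2)"
    using assms by (intro mult_mono) (simp_all add: sinh_def)
  then have "sinh y * sinh y' * (1 - cos (2 * pi * s)) \<le> exp y / 2 * (exp y' / 2) * (20 * s\<^sup>2)"
    using c assms by (intro mult_mono[where a = "sinh y * sinh y'"]) auto
  also have "\<dots> = 5 * (s\<^sup>2 * exp (y + y'))"
    by (simp add: exp_add)
  finally have 2: "sinh y * sinh y' * (1 - cos (2 * pi * s)) \<le> exp R / 5"
    using assms(4) by simp
  have "exp R / 2 \<le> cosh R"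
    by (simp add: cosh_def)
  moreover have "exp R / 8 + exp R / 5 \<le> exp R / 2"
    by simp
  ultimately show ?thesis
    unfolding hclose_def hclose_expand using 1 2 by linarith
qed

lemma hcloseI_exp_radius:
  assumes "0 \<le> r" "r \<le> y" "0 \<le> r'" "r' \<le> y'" "y \<le> R" "y' \<le> R" "\<bar>y - y'\<bar> \<le> R - 3"
    "s\<^sup>2 * exp (y + y') \<le> exp R / 25"
  shows "hclose R r r' s"
proof -
  have "hclose R y y' s"
    using assms by (intro hcloseI_exp) auto
  then have "hclose R y r' s"
    by (rule hclose_mono_radius) (use assms in auto)
  then have "hclose R r' r s"
    by (subst (asm) hclose_sym, elim hclose_mono_radius) (use assms in auto)
  then show ?thesis
    by (simp add: hclose_sym)
qed

text \<open>Jordan's inequality, by concavity of the sine.\<close>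

lemma sin_pi_ge:
  assumes "0 \<le> s" "s \<le> 1 / 2"
  shows "2 * s \<le> sin (pi * s)"
proof -
  have "concave_on {0..pi} sin"
    unfolding concave_on_def
  proof (rule f''_ge0_imp_convex)
    show "((\<lambda>x. - sin x) has_real_derivative - cos x) (at x)" for x :: real
      by (auto intro!: derivative_eq_intros)
    show "((\<lambda>x. - cos x) has_real_derivative sin x) (at x)" for x :: real
      by (auto intro!: derivative_eq_intros)
  qed (auto intro: sin_ge_zero)
  then have "sin ((1 - 2 * s) *\<^sub>R 0 + (2 * s) *\<^sub>R (pi / 2)) \<ge> (1 - 2 * s) * sin 0 + (2 * s) * sin (pi / 2)"
    using assms by (intro concave_onD) auto
  then show ?thesis
    by (simp add: mult.commute)
qed

text \<open>The converse of \<open>hcloseI_exp\<close> up to constants. Radii of at least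
  \<open>ln 2\<close> give \<open>exp x / 4 \<le> sinh x\<close>.\<close>

lemma hcloseD_exp:
  assumes "hclose R r r' s" "\<bar>s\<bar> \<le> 1 / 2" "ln 2 \<le> r" "ln 2 \<le> r'" "0 \<le> R"
  shows "s\<^sup>2 * exp (r + r') \<le> 2 * exp R"
proof -
  have sh: "exp x / 4 \<le> sinh x" if "ln 2 \<le> x" for x :: real
  proof -
    have "2 \<le> exp x"
      using that by (metis exp_le_cancel_iff exp_ln zero_less_numeral)
    then have "2 * 2 \<le> exp x * exp x" by (intro mult_mono) auto
    then show ?thesis
      by (simp add: sinh_def exp_minus field_simps)
  qed
  have "(2 * \<bar>s\<bar>)\<^sup>2 \<le> (sin (pi * \<bar>s\<bar>))\<^sup>2"
    using sin_pi_ge[of "\<bar>s\<bar>"] assms by (intro power_mono) auto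
  also have "(sin (pi * \<bar>s\<bar>))\<^sup>2 = (sin (pi * s))\<^sup>2"
    by (cases "s \<ge> 0") auto
  also have "2 * (sin (pi * s))\<^sup>2 = 1 - cos (2 * pi * s)"
    using cos_double_sin[of "pi * s"] by (simp add: mult.assoc)
  finally have c: "8 * s\<^sup>2 \<le> 1 - cos (2 * pi * s)"
    by (simp add: power_mult_distrib)
  have "s\<^sup>2 * exp (r + r') / 2 = exp r / 4 * (exp r' / 4) * (8 * s\<^sup>2)"
    by (simp add: exp_add)
  also have "\<dots> \<le> sinh r * sinh r' * (1 - cos (2 * pi * s))"
  proof (intro mult_mono c)
    have "0 \<le> r" "0 \<le> r'"
      using assms ln_ge_zero[of 2] by linarith+
    then show "0 \<le> sinh r" "0 \<le> sinh r * sinh r'"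
      by auto
  qed (use sh assms in auto)
  also have "\<dots> \<le> cosh R"
    using assms(1) cosh_real_nonneg[of "r - r'"] unfolding hclose_def hclose_expand by linarith
  also have "\<dots> \<le> exp R"
    using assms by (simp add: cosh_def field_simps)
  finally show ?thesis by simp
qed

text \<open>Box \<open>(d, k)\<close> with \<open>d > 0\<close> is the part of an annulus of width \<open>ln 2\<close>; the root box is the disk of radius
  \<open>inner_radius R\<close>. The constant 1200 makes the boxes so small that also boxes 12 levels apart, one above
  the other, form cliques.\<close>

definition inner_radius :: "real \<Rightarrow> real" where
  "inner_radius R = R / 2 - ln 1200"

definition depth :: "real \<Rightarrow> real \<Rightarrow> nat" where
  "depth R r = nat \<lceil>(r - inner_radius R) / ln 2\<rceil>"

definition outer :: "real \<Rightarrow> nat \<Rightarrow> real" where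
  "outer R j = inner_radius R + real j * ln 2"

lemma exp_outer: "exp (outer R j) = exp (R / 2) / 1200 * 2 ^ j"
  by (simp add: outer_def inner_radius_def exp_add exp_diff exp_of_nat_mult)

lemma exp_outer_add: "exp (outer R i + outer R j) = exp R / 1440000 * 2 ^ (i + j)"
proof -
  have "exp (R / 2) * exp (R / 2) = exp R"
    by (simp add: exp_add[symmetric])
  then show ?thesis
    by (simp add: exp_outer exp_add power_add field_simps)
qed

lemma le_outer_depth: "r \<le> outer R (depth R r)"
proof -
  have "(r - inner_radius R) / ln 2 \<le> real (depth R r)"
    unfolding depth_def by linarith
  then show ?thesis
    by (simp add: outer_def field_simps)
qed

lemma outer_mono: "i \<le> j \<Longrightarrow> outer R i \<le> outer R j"
  by (simp add: outer_def mult_right_mono)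

lemma depth_le_iff: "depth R r \<le> j \<longleftrightarrow> r \<le> outer R j"
proof
  assume "depth R r \<le> j"
  then show "r \<le> outer R j"
    using le_outer_depth[of r R] outer_mono[of "depth R r" j R] by linarith
next
  assume "r \<le> outer R j"
  then have "(r - inner_radius R) / ln 2 \<le> real j"
    by (simp add: outer_def field_simps)
  then show "depth R r \<le> j"
    unfolding depth_def by linarith
qed

lemma abs_diff_scale: "\<bar>2 ^ j * x - 2 ^ j * t\<bar> = \<bar>x - t\<bar> * 2 ^ j" for x t :: real
proof -
  have "2 ^ j * x - 2 ^ j * t = (x - t) * 2 ^ j"
    by (simp add: algebra_simps)
  then show ?thesis
    by (simp add: abs_mult)
qed

lemma abs_scale_power2: "(\<bar>x\<bar> * 2 ^ j)\<^sup>2 = x\<^sup>2 * 2 ^ (j + j)" for x :: real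
proof -
  have "((2::real) ^ j)\<^sup>2 = 2 ^ (j + j)"
    by (simp add: power_mult[symmetric] mult_2_right)
  then show ?thesis
    by (simp only: power_mult_distrib power2_abs)
qed

lemma col_near_dist:
  assumes "\<bar>col j x - col j t\<bar> \<le> n"
  shows "\<bar>x - t\<bar> * 2 ^ j \<le> n + 1"
proof -
  have "\<bar>2 ^ j * x - 2 ^ j * t\<bar> \<le> n + 1"
    using assms unfolding col_def by linarith
  then show ?thesis
    by (simp only: abs_diff_scale)
qed

lemma near_col:
  assumes "\<bar>x - t\<bar> * 2 ^ j \<le> 1"
  shows "\<bar>col j x - col j t\<bar> \<le> 1"
proof -
  have "\<bar>2 ^ j * x - 2 ^ j * t\<bar> \<le> 1"
    using assms by (simp only: abs_diff_scale)
  then show ?thesis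
    unfolding col_def by linarith
qed

section \<open>Hyperbolic points satisfy the axioms of the box graph\<close>

locale hyp_points =
  fixes n :: nat and R :: real and l :: nat and X :: "nat \<Rightarrow> real \<times> real"
  assumes R_large: "2 * ln 1200 + 20 \<le> R" and l_le: "outer R l \<le> R"
    and radius: "i < n \<Longrightarrow> fst (X i) \<in> {0..R}"
begin

definition hadj :: "nat rel" where
  "hadj = {(i, j). i < n \<and> j < n \<and> hyp_dist (X i) (X j) \<le> R}"

text \<open>The orientation is reversed so that angles in \<open>{-pi<..pi}\<close> become positions
  in \<open>{0..<1}\<close>, in line with the half-open columns.\<close>

definition hpos :: "nat \<Rightarrow> real" where
  "hpos i = (pi - snd (X i)) / (2 * pi)"

definition hdep :: "nat \<Rightarrow> nat" where
  "hdep i = depth R (fst (X i))"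

sublocale box_graph "{..<n}" hadj hdep hpos l .

lemma R_pos: "20 \<le> R" "10 \<le> inner_radius R"
proof -
  have "0 \<le> ln (1200::real)"
    by (rule ln_ge_zero) simp
  then show "20 \<le> R" "10 \<le> inner_radius R"
    using R_large unfolding inner_radius_def by linarith+
qed

lemma ln2_bounds: "1 / 2 \<le> ln (2::real)" "ln (2::real) \<le> 1"
  using ln2_ge_two_thirds ln_le_minus_one[of 2] by simp_all

lemma outer_ge: "10 \<le> outer R j"
  using R_pos by (simp add: outer_def add_increasing2)

lemma outer_diff: "outer R j \<le> y \<Longrightarrow> y \<le> R \<Longrightarrow> outer R i \<le> R \<Longrightarrow> \<bar>y - outer R i\<bar> \<le> R - 3"
  using R_pos outer_ge[of i] outer_ge[of j] by linarith

lemma hadj_iff: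
  assumes "i < n" "j < n" "lift i s" "lift j t"
  shows "(i, j) \<in> hadj \<longleftrightarrow> hclose R (fst (X i)) (fst (X j)) (s - t)"
  using hyp_dist_le_iff_hclose[of "fst (X i)" "fst (X j)" R s "snd (X i)" t "snd (X j)"]
    radius[OF assms(1)] radius[OF assms(2)] R_pos assms by (auto simp: hadj_def lift_def hpos_def)

lemma outer_close:
  assumes "i \<le> l" "y \<le> R" "outer R j \<le> y" "0 \<le> r" "r \<le> outer R i" "0 \<le> r'" "r' \<le> y"
    and "s\<^sup>2 * exp (outer R i + y) \<le> exp R / 25"
  shows "hclose R r r' s"
proof (rule hcloseI_exp_radius)
  show "\<bar>outer R i - y\<bar> \<le> R - 3"
    using outer_diff[of j y i] assms l_le outer_mono[of i l R] by (simp add: abs_minus_commute)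
qed (use assms l_le outer_mono[of i l R] in auto)

lemma inboxE:
  assumes "inbox p (j, k)"
  obtains x where "p < n" "hdep p = j" "lift p x" "col j x = k" "fst (X p) \<le> outer R j" "0 \<le> fst (X p)" "fst (X p) \<le> R"
  using assms radius[of p] le_outer_depth[of "fst (X p)" R] by (force simp: inbox_def hdep_def)

lemma hclique_aux:
  assumes "inbox v (i, k)" "inbox w (j, m)" "j \<le> i" "i \<le> Suc j" "i \<le> l" "\<bar>k div 2 ^ (i - j) - m\<bar> \<le> 1"
  shows "(v, w) \<in> hadj"
proof -
  obtain x where x: "v < n" "lift v x" "col i x = k" "fst (X v) \<le> outer R i" "0 \<le> fst (X v)"
    using assms(1) by (rule inboxE)
  obtain y where y: "w < n" "lift w y" "col j y = m" "fst (X w) \<le> outer R j" "0 \<le> fst (X w)"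
    using assms(2) by (rule inboxE)
  have "col j x = k div 2 ^ (i - j)"
    using col_add_div[of j "i - j" x] x assms(3) by simp
  then have "\<bar>x - y\<bar> * 2 ^ j \<le> 2"
    using col_near_dist[of j x y 1] assms(6) y by simp
  then have "(\<bar>x - y\<bar> * 2 ^ j)\<^sup>2 \<le> 2\<^sup>2"
    by (intro power_mono) auto
  then have "(x - y)\<^sup>2 * 2 ^ (j + j) \<le> 4"
    unfolding abs_scale_power2 by simp
  moreover have "(2::real) ^ (i + j) \<le> 2 * 2 ^ (j + j)"
    using power_increasing[of "i + j" "Suc (j + j)" "2::real"] assms(4) by simp
  ultimately have "(x - y)\<^sup>2 * 2 ^ (i + j) \<le> 8"
    using mult_left_mono[of "2 ^ (i + j)" "2 * 2 ^ (j + j)" "(x - y)\<^sup>2"] by simp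
  then have "(x - y)\<^sup>2 * 2 ^ (i + j) * (exp R / 1440000) \<le> 8 * (exp R / 1440000)"
    by (intro mult_right_mono) auto
  then have "(x - y)\<^sup>2 * exp (outer R i + outer R j) \<le> exp R / 25"
    unfolding exp_outer_add by (simp add: mult_ac)
  then have "hclose R (fst (X v)) (fst (X w)) (x - y)"
    using x y assms l_le outer_mono[of j l R] by (intro outer_close[of i _ j]) auto
  then show ?thesis
    using hadj_iff x y by blast
qed

lemma hadj_sym: "(v, w) \<in> hadj \<Longrightarrow> (w, v) \<in> hadj"
  by (cases "X v"; cases "X w") (auto simp: hadj_def hyp_dist_def mult.commute cos_diff)

lemma hclique:
  assumes "inbox v b" "inbox w c" "boxadj b c" "fst b \<le> l" "fst c \<le> l"
  shows "(v, w) \<in> hadj"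
proof -
  obtain i k j m where bc: "b = (i, k)" "c = (j, m)"
    by (cases b; cases c)
  from assms(3) consider "i = j" "\<bar>k - m\<bar> \<le> 1" | "i = Suc j" "\<bar>k div 2 - m\<bar> \<le> 1"
    | "j = Suc i" "\<bar>m div 2 - k\<bar> \<le> 1"
    by (auto simp: boxadj_def bc)
  then show ?thesis
    using hclique_aux[of v i k w j m] hclique_aux[of w j m v i k] assms hadj_sym
    by cases (auto simp: bc)
qed

lemma hdep_less: "j < hdep w \<Longrightarrow> outer R j < fst (X w)"
  using depth_le_iff[of R "fst (X w)" j] by (simp add: hdep_def not_le[symmetric])

lemma hadj_angle:
  assumes e: "(u, w) \<in> hadj" "lift u s" "lift w t" "\<bar>s - t\<bar> \<le> 1 / 2" "1 \<le> fst (X u)" "1 \<le> fst (X w)"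
  shows "(s - t)\<^sup>2 * exp (fst (X u) + fst (X w)) \<le> 2 * exp R"
proof (rule hcloseD_exp)
  show "hclose R (fst (X u)) (fst (X w)) (s - t)"
    using e hadj_iff[of u w s t] by (auto simp: hadj_def)
qed (use e ln2_bounds R_pos in auto)

text \<open>If \<open>w\<close> is at most 12 levels below \<open>p\<close>, the two are close
  directly. Otherwise the depth of \<open>w\<close> makes the edge confine the angle between
  \<open>u\<close> and \<open>w\<close>, with a gain of \<open>4096 = 2 ^ 12\<close> over what
  \<open>p\<close> needs, and \<open>p\<close> is close to \<open>u\<close>.\<close>

lemma hray:
  assumes e: "(u, w) \<in> hadj" "lift u s" "lift w t" "\<bar>s - t\<bar> \<le> 1 / 2"
    and j: "j \<le> l" "hdep u \<le> j + 12" "\<bar>k - col j t\<bar> \<le> 1" and p: "inbox p (j, k)"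
  shows "(p, u) \<in> hadj \<or> (p, w) \<in> hadj"
proof -
  have uw: "u < n" "w < n"
    using e by (auto simp: hadj_def)
  obtain x where x: "p < n" "lift p x" "col j x = k" "fst (X p) \<le> outer R j" "0 \<le> fst (X p)"
    using p by (rule inboxE)
  have "\<bar>x - t\<bar> * 2 ^ j \<le> 2"
    using col_near_dist[of j x t 1] j x by simp
  then have "(\<bar>x - t\<bar> * 2 ^ j)\<^sup>2 \<le> 2\<^sup>2"
    by (intro power_mono) auto
  then have xt: "(x - t)\<^sup>2 * 2 ^ (j + j) \<le> 4"
    unfolding abs_scale_power2 by simp
  then have "(x - t)\<^sup>2 * 2 ^ (j + j) * (4096 * (exp R / 1440000)) \<le> 4 * (4096 * (exp R / 1440000))"
    by (intro mult_right_mono) auto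
  moreover have "exp (outer R j + outer R (j + 12)) = 2 ^ (j + j) * (4096 * (exp R / 1440000))"
    unfolding exp_outer_add add.assoc[symmetric] power_add[of 2 "j + j"] by simp
  ultimately have xt': "(x - t)\<^sup>2 * exp (outer R j + outer R (j + 12)) \<le> 4 * (4096 * (exp R / 1440000))"
    by (simp only: mult.assoc)
  have oj: "outer R j \<le> R"
    using l_le outer_mono[of j l R] j by linarith
  have ru: "0 \<le> fst (X u)" "fst (X u) \<le> R" "fst (X u) \<le> outer R (j + 12)"
    using radius[of u] uw j(2) depth_le_iff[of R "fst (X u)" "j + 12"] by (auto simp: hdep_def)
  have rw: "0 \<le> fst (X w)" "fst (X w) \<le> R"
    using radius[of w] uw by auto
  show ?thesis
  proof (cases "hdep w \<le> j + 12")
    case True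
    then have "fst (X w) \<le> outer R (j + 12)"
      using depth_le_iff[of R "fst (X w)" "j + 12"] by (auto simp: hdep_def)
    \<comment> \<open>Twelve levels further down, \<open>outer\<close> may already exceed
      \<open>R\<close>.\<close>
    then have w: "fst (X w) \<le> min R (outer R (j + 12))"
      using rw by simp
    have "(x - t)\<^sup>2 * exp (outer R j + min R (outer R (j + 12))) \<le> (x - t)\<^sup>2 * exp (outer R j + outer R (j + 12))"
      by (intro mult_left_mono) auto
    also have "\<dots> \<le> exp R / 25"
      using xt' exp_gt_zero[of R] by linarith
    finally have "hclose R (fst (X p)) (fst (X w)) (x - t)"
      using x w rw j oj outer_mono[of j "j + 12" R] by (intro outer_close[of j _ j]) auto
    then show ?thesis
      using hadj_iff x uw e by blast
  next
    case False
    then have w: "outer R (j + 12) < fst (X w)"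
      using hdep_less by simp
    have o12: "outer R (j + 12) = outer R j + 12 * ln 2"
      by (simp add: outer_def algebra_simps)
    have oj12: "outer R j \<le> R - 12 * ln 2"
      using w rw o12 by linarith
    show ?thesis
    \<comment> \<open>\<open>hadj_angle\<close> speaks of radii of at least 1. Close to the origin
      the triangle inequality through the origin takes over.\<close>
    proof (cases "fst (X u) \<le> 12 * ln 2")
      case True
      then have "hclose R (fst (X p)) (fst (X u)) (x - s)"
        using x oj12 ru by (intro hclose_of_add_le) auto
      then show ?thesis
        using hadj_iff x uw e by blast
    next
      case False
      then have st: "(s - t)\<^sup>2 * exp (fst (X u) + fst (X w)) \<le> 2 * exp R"
        using e w outer_ge[of "j + 12"] ln2_bounds by (intro hadj_angle) auto
      have "(x - s)\<^sup>2 \<le> 2 * (x - t)\<^sup>2 + 2 * (s - t)\<^sup>2"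
        using zero_le_power2[of "(x - t) + (s - t)"] by (simp add: power2_eq_square algebra_simps)
      then have "(x - s)\<^sup>2 * exp (outer R j + fst (X u))
          \<le> (2 * (x - t)\<^sup>2 + 2 * (s - t)\<^sup>2) * exp (outer R j + fst (X u))"
        by (intro mult_right_mono) auto
      also have "\<dots> = 2 * ((x - t)\<^sup>2 * exp (outer R j + fst (X u))) + 2 * ((s - t)\<^sup>2 * exp (outer R j + fst (X u)))"
        by (simp add: algebra_simps)
      also have "(x - t)\<^sup>2 * exp (outer R j + fst (X u)) \<le> (x - t)\<^sup>2 * exp (outer R j + outer R (j + 12))"
        using ru by (intro mult_left_mono) auto
      also have "(s - t)\<^sup>2 * exp (outer R j + fst (X u)) \<le> (s - t)\<^sup>2 * (exp (fst (X u) + fst (X w)) / 4096)"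
      proof (intro mult_left_mono)
        have "exp (outer R j + fst (X u)) * exp (12 * ln 2) \<le> exp (fst (X u) + fst (X w))"
          using w o12 by (simp add: exp_add[symmetric])
        moreover have "exp (12 * ln 2) = (4096::real)"
          using exp_of_nat_mult[of 12 "ln 2 :: real"] by simp
        ultimately show "exp (outer R j + fst (X u)) \<le> exp (fst (X u) + fst (X w)) / 4096"
          by simp
      qed simp
      \<comment> \<open>Numerically, \<open>8 * 4096 / 1440000 + 4 / 4096\<close> is less than
        \<open>1 / 25\<close>.\<close>
      finally have "(x - s)\<^sup>2 * exp (outer R j + fst (X u)) \<le> exp R / 25"
        using xt' st exp_gt_zero[of R] unfolding times_divide_eq_right by linarith
      moreover have "\<bar>outer R j - fst (X u)\<bar> \<le> R - 3"
        using ru o12 oj12 ln2_bounds R_pos by linarith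
      ultimately have "hclose R (fst (X p)) (fst (X u)) (x - s)"
        using x ru oj by (intro hcloseI_exp_radius[of _ "outer R j" _ "fst (X u)"]) auto
      then show ?thesis
        using hadj_iff x uw e by blast
    qed
  qed
qed

text \<open>Depth greater than \<open>j + 11\<close> puts both radii above
  \<open>outer R (j + 11)\<close>, and the edge then forces an angle of at most
  \<open>1 / 2 ^ j\<close>, because \<open>2 * 1200 ^ 2 \<le> 4 ^ 11\<close>. This bounds 1200 from
  above, as the cliques bound it from below.\<close>

lemma hnear:
  assumes e: "(u, w) \<in> hadj" "lift u s" "lift w t" "\<bar>s - t\<bar> \<le> 1 / 2" and d: "hdep u \<le> hdep w"
  shows "\<bar>col (hdep u - 12) s - col (hdep u - 12) t\<bar> \<le> 1"
proof (cases "hdep u \<le> 12")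
  case True
  then show ?thesis
    using e by (intro near_col) simp
next
  case False
  define j where "j = hdep u - 12"
  have j: "j + 11 < hdep u" "j + 11 < hdep w"
    using False d by (simp_all add: j_def)
  then have r: "outer R (j + 11) < fst (X u)" "outer R (j + 11) < fst (X w)"
    using hdep_less by blast+
  then have "(s - t)\<^sup>2 * exp (outer R (j + 11) + outer R (j + 11)) \<le> (s - t)\<^sup>2 * exp (fst (X u) + fst (X w))"
    by (intro mult_left_mono) auto
  also have "\<dots> \<le> 2 * exp R"
    using e r outer_ge[of "j + 11"] by (intro hadj_angle) auto
  also have "exp (outer R (j + 11) + outer R (j + 11)) = exp R * (4194304 / 1440000 * 2 ^ (j + j))"
  proof -
    have "(j + 11) + (j + 11) = (j + j) + 22"
      by simp
    then show ?thesis
      unfolding exp_outer_add by (simp only: power_add[of 2 "j + j"]) simp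
  qed
  finally have "exp R * ((s - t)\<^sup>2 * (4194304 / 1440000 * 2 ^ (j + j))) \<le> exp R * 2"
    by (simp add: mult_ac)
  then have "(s - t)\<^sup>2 * (4194304 / 1440000 * 2 ^ (j + j)) \<le> 2"
    by simp
  then have "(s - t)\<^sup>2 * 2 ^ (j + j) \<le> 1"
    by simp
  then have "(\<bar>s - t\<bar> * 2 ^ j)\<^sup>2 \<le> 1\<^sup>2"
    unfolding abs_scale_power2 by simp
  then have "\<bar>s - t\<bar> * 2 ^ j \<le> 1"
    by (rule power2_le_imp_le) simp
  then show ?thesis
    unfolding j_def by (rule near_col)
qed

text \<open>Replacing one end of the edge by \<open>p\<close> lowers a radius and the angle, and
  \<open>hclose\<close> is monotone in both.\<close>

lemma hcross:
  assumes e: "(u, w) \<in> hadj" "lift u s" "lift w t" "lift p x" "p \<in> {..<n}" "hdep p \<le> l" "l < hdep u" "l < hdep w"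
    "s \<le> x" "x \<le> t" "t - s \<le> 1 / 2"
  shows "(u, p) \<in> hadj \<and> (p, w) \<in> hadj"
proof -
  have uw: "u < n" "w < n" "p < n"
    using e by (auto simp: hadj_def)
  have "fst (X p) \<le> outer R l"
    using e(6) depth_le_iff[of R "fst (X p)" l] by (simp add: hdep_def)
  then have r: "0 \<le> fst (X p)" "fst (X p) \<le> fst (X u)" "fst (X p) \<le> fst (X w)" "fst (X u) \<le> R" "fst (X w) \<le> R"
    "0 \<le> fst (X u)" "0 \<le> fst (X w)"
    using hdep_less[OF e(7)] hdep_less[OF e(8)] radius uw by (auto simp: less_imp_le)
  have h: "hclose R (fst (X u)) (fst (X w)) (s - t)"
    using hadj_iff uw e by blast
  have "hclose R (fst (X u)) (fst (X w)) (s - x)"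
    using h by (rule hclose_mono_angle) (use e r in auto)
  then have 1: "hclose R (fst (X u)) (fst (X p)) (s - x)"
    by (rule hclose_mono_radius) (use r in auto)
  have "hclose R (fst (X w)) (fst (X u)) (x - t)"
    unfolding hclose_sym[of R "fst (X w)"] using h by (rule hclose_mono_angle) (use e r in auto)
  then have "hclose R (fst (X w)) (fst (X p)) (x - t)"
    by (rule hclose_mono_radius) (use r in auto)
  then have 2: "hclose R (fst (X p)) (fst (X w)) (x - t)"
    by (simp add: hclose_sym)
  show ?thesis
    using hadj_iff uw e 1 2 by blast
qed

lemma hadj_refl: "v \<in> {..<n} \<Longrightarrow> (v, v) \<in> hadj"
  using radius[of v] R_pos hyp_dist_le_iff[of "fst (X v)" "fst (X v)" R "snd (X v)" "snd (X v)"]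
    hyperbolic_pythagoras[of "fst (X v)"] cosh_real_ge_1[of R]
  by (simp add: hadj_def power2_eq_square)

sublocale box_graph_adj "{..<n}" hadj hdep hpos l
proof
  show "hadj \<subseteq> {..<n} \<times> {..<n}"
    by (auto simp: hadj_def)
qed (fact hadj_refl hadj_sym hclique hray hnear hcross)+

text \<open>The worst case is that both points lie on the boundary circle of radius
  \<open>R\<close>.\<close>

lemma low_clique:
  assumes "v < n" "w < n" "lift v s" "lift w t" "\<bar>s - t\<bar> * exp (R / 2) \<le> 1 / 5"
  shows "(v, w) \<in> hadj"
proof -
  have "(\<bar>s - t\<bar> * exp (R / 2))\<^sup>2 \<le> (1 / 5)\<^sup>2"
    using assms(5) by (intro power_mono) auto
  moreover have "exp (R / 2) * exp (R / 2) = exp R"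
    by (simp add: exp_add[symmetric])
  ultimately have "(s - t)\<^sup>2 * exp R \<le> 1 / 25"
    by (simp add: power_mult_distrib power2_eq_square[of "exp (R / 2)"] power2_eq_square[of "1 / 5 :: real"])
  then have "(s - t)\<^sup>2 * exp R * exp R \<le> 1 / 25 * exp R"
    by (intro mult_right_mono) auto
  then have "(s - t)\<^sup>2 * exp (R + R) \<le> exp R / 25"
    unfolding exp_add[of R R] by linarith
  then have "hclose R (fst (X v)) (fst (X w)) (s - t)"
    using radius assms R_pos by (intro hcloseI_exp_radius[of _ R _ R]) auto
  then show ?thesis
    using hadj_iff assms by blast
qed

end

section \<open>Far vertices yield large connected sets of boxes\<close>

text \<open>The representative on the circle of a box on the cover: sets of boxes are finite and can
  be counted only after this identification.\<close>

definition reduce :: "box \<Rightarrow> box" where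
  "reduce b = (fst b, snd b mod 2 ^ fst b)"

text \<open>The children of three consecutive columns fill six columns, whence the bound
  \<open>12 = 3 + 6 + 3\<close>.\<close>

definition nbrs :: "box \<Rightarrow> box set" where
  "nbrs b = reduce ` ({fst b} \<times> {snd b - 1..snd b + 1}
     \<union> {Suc (fst b)} \<times> {2 * snd b - 2..2 * snd b + 3}
     \<union> {fst b - 1} \<times> {snd b div 2 - 1..snd b div 2 + 1})"

lemma finite_nbrs [simp]: "finite (nbrs b)"
  by (simp add: nbrs_def)

lemma card_nbrs: "card (nbrs b) \<le> 12"
proof -
  let ?A = "{fst b} \<times> {snd b - 1..snd b + 1}" and ?B = "{Suc (fst b)} \<times> {2 * snd b - 2..2 * snd b + 3}"
    and ?C = "{fst b - 1} \<times> {snd b div 2 - 1..snd b div 2 + 1}"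
  have "card (nbrs b) \<le> card (?A \<union> ?B \<union> ?C)"
    unfolding nbrs_def by (rule card_image_le) simp
  also have "\<dots> \<le> card ?A + card ?B + card ?C"
    by (meson add_right_mono card_Un_le le_trans)
  also have "\<dots> = 12"
    by (simp add: card_cartesian_product)
  finally show ?thesis .
qed

lemma reduce_shift: "reduce (d, k + 2 ^ d * z) = reduce (d, k)"
  by (simp add: reduce_def)

lemma boxadj_shift:
  assumes "boxadj (d, k) (e, m)"
  shows "boxadj (d, k + 2 ^ d * z) (e, m + 2 ^ e * z)"
proof -
  have "(k + 2 * 2 ^ i * z) div 2 = k div 2 + 2 ^ i * z" for k :: int and i
    using div_mult_self1[of 2 k "2 ^ i * z"] by (simp add: mult.assoc mult.left_commute)
  then show ?thesis
    using assms by (auto simp: boxadj_def)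
qed

text \<open>Adjacency survives a common shift by full turns, which may be chosen to move
  \<open>b\<close> to its representative.\<close>

lemma boxadj_nbrs:
  assumes "boxadj b c"
  shows "reduce c \<in> nbrs (reduce b)"
proof -
  have *: "reduce y \<in> nbrs x" if "boxadj x y" for x y
  proof -
    have "y \<in> {fst x} \<times> {snd x - 1..snd x + 1} \<union> {Suc (fst x)} \<times> {2 * snd x - 2..2 * snd x + 3}
      \<union> {fst x - 1} \<times> {snd x div 2 - 1..snd x div 2 + 1}"
      using that by (cases x; cases y) (auto simp: boxadj_def)
    then show ?thesis
      unfolding nbrs_def by blast
  qed
  obtain d k e m where bc: "b = (d, k)" "c = (e, m)"
    by (cases b; cases c)
  define z where "z = - (k div 2 ^ d)"
  have "k + 2 ^ d * z = k mod 2 ^ d"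
    by (simp add: z_def minus_div_mult_eq_mod[symmetric] mult.commute)
  then show ?thesis
    using *[OF boxadj_shift[OF assms[unfolded bc], of z]] by (simp add: bc reduce_shift) (simp add: reduce_def)
qed

definition walks :: "nat \<Rightarrow> box list set" where
  "walks n = {xs. length xs = Suc n \<and> hd xs = (0, 0) \<and> successively (\<lambda>b c. c \<in> nbrs b) xs}"

lemma finite_card_walks: "finite (walks n) \<and> card (walks n) \<le> 12 ^ n"
proof (induction n)
  case 0
  have "walks 0 = {[(0, 0)]}"
    by (auto simp: walks_def length_Suc_conv)
  then show ?case by simp
next
  case (Suc n)
  have sub: "walks (Suc n) \<subseteq> (\<Union>xs\<in>walks n. (\<lambda>y. xs @ [y]) ` nbrs (last xs))"
  proof
    fix ys assume "ys \<in> walks (Suc n)"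
    then have ys: "length ys = Suc (Suc n)" "hd ys = (0, 0)" "successively (\<lambda>b c. c \<in> nbrs b) ys"
      by (auto simp: walks_def)
    then obtain xs y where xy: "ys = xs @ [y]"
      by (metis length_0_conv nat.distinct(1) rev_exhaust)
    with ys have "xs \<noteq> []" by auto
    with ys xy have "xs \<in> walks n" "y \<in> nbrs (last xs)"
      by (auto simp: walks_def successively_append_iff)
    with xy show "ys \<in> (\<Union>xs\<in>walks n. (\<lambda>y. xs @ [y]) ` nbrs (last xs))"
      by blast
  qed
  have fin: "finite (\<Union>xs\<in>walks n. (\<lambda>y. xs @ [y]) ` nbrs (last xs))"
    using Suc by simp
  have "card (walks (Suc n)) \<le> card (\<Union>xs\<in>walks n. (\<lambda>y. xs @ [y]) ` nbrs (last xs))"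
    using sub fin by (rule card_mono[rotated])
  also have "\<dots> \<le> (\<Sum>xs\<in>walks n. card ((\<lambda>y. xs @ [y]) ` nbrs (last xs)))"
    using Suc by (intro card_UN_le) simp
  also have "\<dots> \<le> (\<Sum>xs\<in>walks n. 12)"
    by (intro sum_mono) (meson card_image_le card_nbrs finite_nbrs le_trans)
  also have "\<dots> \<le> 12 ^ Suc n"
    using Suc by simp
  finally show ?case
    using sub fin by (blast intro: finite_subset)
qed

text \<open>Every connected set is covered by a closed walk that grows by a detour \<open>y, x, y\<close> for each new
  point \<open>x\<close>.\<close>

lemma covering_walk:
  assumes "r \<in> Q" "Rel \<subseteq> Q \<times> Q" "sym Rel" "\<And>x. x \<in> Q \<Longrightarrow> (r, x) \<in> Rel\<^sup>*" "finite Q"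
    and "Suc m \<le> card Q"
  shows "\<exists>xs. length xs = Suc (2 * m) \<and> hd xs = r \<and> set xs \<subseteq> Q \<and> card (set xs) = Suc m
    \<and> successively (\<lambda>x y. (x, y) \<in> Rel) xs"
  using assms(6)
proof (induction m)
  case 0
  then show ?case
    using assms(1) by (intro exI[of _ "[r]"]) auto
next
  case (Suc m)
  then obtain xs where xs: "length xs = Suc (2 * m)" "hd xs = r" "set xs \<subseteq> Q" "card (set xs) = Suc m"
    "successively (\<lambda>x y. (x, y) \<in> Rel) xs"
    by auto
  have "\<not> Q \<subseteq> set xs"
    using Suc.prems xs card_mono[of "set xs" Q] by auto
  then obtain x0 where x0: "x0 \<in> Q" "x0 \<notin> set xs"
    by blast
  have "\<exists>y x. (y, x) \<in> Rel \<and> y \<in> set xs \<and> x \<notin> set xs"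
  proof (rule ccontr)
    assume *: "\<not> ?thesis"
    have "(r, x) \<in> Rel\<^sup>* \<Longrightarrow> x \<in> set xs" for x
    proof (induction rule: rtrancl_induct)
      case base
      then show ?case
        using xs by (metis hd_in_set length_0_conv nat.distinct(1))
    qed (use * in blast)
    with x0 assms(4) show False by blast
  qed
  then obtain y x where yx: "(y, x) \<in> Rel" "y \<in> set xs" "x \<notin> set xs"
    by blast
  then obtain as bs where ab: "xs = as @ y # bs"
    by (meson split_list)
  let ?ys = "as @ y # x # y # bs"
  have "(x, y) \<in> Rel" "x \<in> Q"
    using yx assms(2,3) by (auto dest: symD)
  then have "successively (\<lambda>x y. (x, y) \<in> Rel) ?ys"
    using xs(5) yx(1) by (simp add: ab successively_append_iff successively_Cons)
  moreover have "set ?ys = insert x (set xs)"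
    by (auto simp: ab)
  moreover have "hd ?ys = r"
    using xs(2) by (cases as) (auto simp: ab)
  ultimately show ?case
    using xs yx \<open>x \<in> Q\<close> by (intro exI[of _ ?ys]) (simp add: ab)
qed

section \<open>The explored boxes as a connected set on the circle\<close>

context box_graph
begin

lemma lift_diff: "lift v s \<Longrightarrow> lift v t \<Longrightarrow> \<exists>z::int. t = s + of_int z"
proof -
  assume "lift v s" "lift v t"
  then have "t - s \<in> \<int>"
    unfolding lift_def using Ints_diff[of "t - pos v" "s - pos v"] by simp
  then show ?thesis
    by (auto elim!: Ints_cases simp: algebra_simps)
qed

lemma lift_add_int: "lift v s \<Longrightarrow> lift v (s + of_int z)"
  unfolding lift_def using Ints_add[of "s - pos v" "of_int z"] by (simp add: algebra_simps)

lemma col_shift: "col j (t + of_int z) = col j t + 2 ^ j * z"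
proof -
  have "2 ^ j * (t + of_int z) = 2 ^ j * t + of_int (2 ^ j * z)"
    by (simp add: algebra_simps)
  then show ?thesis
    unfolding col_def by (simp only: floor_add_int)
qed

lemma reduce_col_lift: "lift v s \<Longrightarrow> lift v t \<Longrightarrow> reduce (j, col j s + k) = reduce (j, col j t + k)"
  using lift_diff[of v s t] reduce_shift[of j "col j s + k"] by (auto simp: col_shift algebra_simps)

lemma inbox_reduce: "inbox v (reduce b) \<longleftrightarrow> inbox v b"
proof -
  obtain d k where b: "b = (d, k)" by (cases b)
  have *: "inbox v (d, m + 2 ^ d * z)" if "inbox v (d, m)" for m z
    using that lift_add_int col_shift by (auto simp: inbox_def) (metis)
  have r: "reduce b = (d, k + 2 ^ d * (- (k div 2 ^ d)))"
    by (simp add: reduce_def b minus_div_mult_eq_mod[symmetric] mult.commute)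
  show ?thesis
    using *[of k "- (k div 2 ^ d)"] *[of "k + 2 ^ d * (- (k div 2 ^ d))" "k div 2 ^ d"]
    unfolding r by (auto simp: b)
qed

lemma active_reduce: "active (reduce b) \<longleftrightarrow> active b"
  by (simp add: active_def inbox_reduce)

text \<open>Two rays, three columns wide, over \<open>l + 1\<close> depths.\<close>

lemma card_reduce_rays: "finite (reduce ` rays u v) \<and> card (reduce ` rays u v) \<le> 6 * (l + 1)"
proof -
  let ?A = "{..l} \<times> {u, v} \<times> {-1, 0, 1 :: int}"
  let ?f = "\<lambda>(j, w, e). reduce (j, col j (pos w) + e)"
  have "reduce ` rays u v \<subseteq> ?f ` ?A"
  proof
    fix c assume "c \<in> reduce ` rays u v"
    then obtain j k where c': "c = reduce (j, k)" "(j, k) \<in> rays u v"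
      by auto
    then obtain w t where c: "c = reduce (j, k)" "j \<le> l" "w \<in> {u, v}" "lift w t" "\<bar>k - col j t\<bar> \<le> 1"
      by (auto simp: rays_def)
    define e where "e = k - col j t"
    have "e \<in> {-1, 0, 1}"
      using c(5) by (auto simp: e_def)
    moreover have "c = reduce (j, col j (pos w) + e)"
      using reduce_col_lift[OF c(4) lift_pos, of j e] c(1) by (simp add: e_def)
    ultimately show "c \<in> ?f ` ?A"
      using c(2,3) by (intro image_eqI[of _ _ "(j, w, e)"]) auto
  qed
  moreover have "card (?f ` ?A) \<le> 6 * (l + 1)"
  proof -
    have "card (?f ` ?A) \<le> card ?A"
      by (rule card_image_le) simp
    also have "\<dots> = (l + 1) * (card {u, v} * 3)"
      unfolding card_cartesian_product by simp
    also have "\<dots> \<le> (l + 1) * (2 * 3)"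
      by (intro mult_left_mono mult_right_mono) (auto simp: card_insert_if)
    finally show ?thesis by simp
  qed
  ultimately show ?thesis
    by (meson card_mono finite.emptyI finite.insertI finite_SigmaI finite_atMost finite_imageI finite_subset le_trans)
qed

abbreviation explored :: "'v \<Rightarrow> 'v \<Rightarrow> box set" where
  "explored u v \<equiv> rays u v \<union> holes u v"

lemma explored_depth: "b \<in> explored u v \<Longrightarrow> fst b \<le> l"
  using holesD[of b u v] by (auto simp: rays_def)

lemma finite_reduce_explored: "finite (reduce ` explored u v)"
proof (rule finite_subset)
  show "reduce ` explored u v \<subseteq> (SIGMA d:{..l}. {0..<2 ^ d})"
    using explored_depth by (fastforce simp: reduce_def)
qed auto

definition explored_edges :: "'v \<Rightarrow> 'v \<Rightarrow> box rel" where
  "explored_edges u v = {(reduce b, reduce c) |b c. b \<in> explored u v \<and> c \<in> explored u v \<and> boxadj b c}"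

lemma explored_edgeI: "b \<in> explored u v \<Longrightarrow> c \<in> explored u v \<Longrightarrow> boxadj b c \<Longrightarrow> (reduce b, reduce c) \<in> explored_edges u v"
  unfolding explored_edges_def by blast

lemma explored_connected: "b \<in> explored u v \<Longrightarrow> ((0, 0), reduce b) \<in> (explored_edges u v)\<^sup>*"
proof -
  have ray: "((0, 0), reduce b) \<in> (explored_edges u v)\<^sup>*" if b: "b \<in> rays u v" for b
  proof -
    obtain w t where w: "w \<in> {u, v}" "lift w t" "\<bar>snd b - col (fst b) t\<bar> \<le> 1" "fst b \<le> l"
      using b by (auto simp: rays_def)
    have r: "(j, col j t) \<in> rays u v" if "j \<le> l" for j
      using w that by (auto simp: rays_def intro: exI[of _ t])
    have "j \<le> l \<Longrightarrow> ((0, 0), reduce (j, col j t)) \<in> (explored_edges u v)\<^sup>*" for j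
    proof (induction j)
      case (Suc j)
      have "(reduce (j, col j t), reduce (Suc j, col (Suc j) t)) \<in> explored_edges u v"
        using Suc.prems r[of j] r[of "Suc j"] by (intro explored_edgeI) (auto simp: boxadj_def col_Suc_div)
      with Suc show ?case by (meson Suc_leD rtrancl.rtrancl_into_rtrancl)
    qed (simp add: reduce_def)
    moreover have "(reduce (fst b, col (fst b) t), reduce b) \<in> explored_edges u v"
      using w b r[of "fst b"] by (intro explored_edgeI) (auto simp: boxadj_def)
    ultimately show ?thesis
      using w(4) by (meson rtrancl.rtrancl_into_rtrancl)
  qed
  have "((0, 0), reduce b) \<in> (explored_edges u v)\<^sup>*" if "b \<in> holes u v" for b
    using that
  proof (induction rule: holes.induct)
    case (step b c)
    then have "(reduce b, reduce c) \<in> explored_edges u v"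
      by (intro explored_edgeI) (auto intro: holes.step)
    with step show ?case by (meson rtrancl.rtrancl_into_rtrancl)
  qed (rule ray)
  with ray show "b \<in> explored u v \<Longrightarrow> ((0, 0), reduce b) \<in> (explored_edges u v)\<^sup>*"
    by blast
qed

lemma root_explored: "(0, 0) \<in> reduce ` explored u v"
proof -
  have "(0, col 0 (pos u)) \<in> rays u v"
    by (auto simp: rays_def intro: exI[of _ "pos u"])
  moreover have "reduce (0, col 0 (pos u)) = (0, 0)"
    by (simp add: reduce_def)
  ultimately show ?thesis
    by (metis UnI1 imageI)
qed

text \<open>The witness over which the union bound runs: \<open>F\<close> collects the holes on a
  walk through \<open>m + 1\<close> explored boxes, of which the rays account for at most
  \<open>6 * (l + 1)\<close>.\<close>

definition empty_walk :: "nat \<Rightarrow> box list \<Rightarrow> box set \<Rightarrow> bool" where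
  "empty_walk m xs F \<longleftrightarrow> xs \<in> walks (2 * m) \<and> F \<subseteq> set xs \<and> m \<le> card F + 6 * (l + 1)
     \<and> (\<forall>b\<in>F. fst b \<le> l \<and> snd b \<in> {0..<2 ^ fst b} \<and> \<not> active b)"

lemma empty_walk_exists:
  assumes "Suc m \<le> card (reduce ` explored u v)"
  shows "\<exists>xs F. empty_walk m xs F"
proof -
  let ?Q = "reduce ` explored u v"
  obtain xs where xs: "length xs = Suc (2 * m)" "hd xs = (0, 0)" "set xs \<subseteq> ?Q" "card (set xs) = Suc m"
    "successively (\<lambda>x y. (x, y) \<in> explored_edges u v) xs"
  proof -
    have 1: "sym (explored_edges u v)"
      unfolding sym_def explored_edges_def using boxadj_sym by blast
    have 2: "explored_edges u v \<subseteq> ?Q \<times> ?Q"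
      unfolding explored_edges_def by blast
    have 3: "((0, 0), x) \<in> (explored_edges u v)\<^sup>*" if "x \<in> ?Q" for x
      using that explored_connected by blast
    show ?thesis
      using covering_walk[OF root_explored 2 1 3 finite_reduce_explored assms] that by blast
  qed
  have "successively (\<lambda>b c. c \<in> nbrs b) xs"
    by (rule successively_mono[OF xs(5)]) (use boxadj_nbrs in \<open>auto simp: explored_edges_def\<close>)
  then have "xs \<in> walks (2 * m)"
    using xs by (simp add: walks_def)
  moreover define F where "F = set xs \<inter> reduce ` holes u v"
  have "card (set xs) \<le> card F + card (reduce ` rays u v)"
  proof -
    have "set xs \<subseteq> F \<union> reduce ` rays u v"
      using xs(3) by (auto simp: F_def)
    then show ?thesis
      using card_reduce_rays[of u v] card_mono[of "F \<union> reduce ` rays u v" "set xs"]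
        card_Un_le[of F "reduce ` rays u v"] by (simp add: F_def)
  qed
  then have "m \<le> card F + 6 * (l + 1)"
    using card_reduce_rays[of u v] xs(4) by linarith
  moreover have "fst b \<le> l \<and> snd b \<in> {0..<2 ^ fst b} \<and> \<not> active b" if "b \<in> F" for b
    using that holesD by (auto simp: F_def active_reduce) (auto simp: reduce_def)
  ultimately show ?thesis
    unfolding empty_walk_def by (blast intro: F_def[THEN equalityD1, THEN subsetD, THEN IntD1])
qed

end

locale cell_graph = box_graph_adj V adj dep pos l
  for V :: "'v set" and adj dep pos l +
  fixes M :: nat
  assumes M_pos: "0 < M"
    and low_cell: "\<lbrakk>v \<in> V; w \<in> V; lift v s; lift w t; \<lfloor>2 ^ l * real M * s\<rfloor> = \<lfloor>2 ^ l * real M * t\<rfloor>\<rbrakk> \<Longrightarrow> (v, w) \<in> adj"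
begin

text \<open>Vertices below a bottom box are too spread out to form one clique, so its sector is cut
  into \<open>M\<close> pieces with tags 1 to \<open>M\<close>. Tag 0 marks vertices inside a
  box.\<close>

definition cell :: "'v \<Rightarrow> box \<times> nat" where
  "cell w = (reduce (min (dep w) l, col (min (dep w) l) (pos w)),
     if dep w \<le> l then 0 else Suc (nat (\<lfloor>2 ^ l * real M * pos w\<rfloor> mod int M)))"

lemma cell_clique:
  assumes "v \<in> V" "w \<in> V" "cell v = cell w"
  shows "(v, w) \<in> adj"
proof (cases "dep v \<le> l")
  case True
  then have w: "dep w \<le> l"
    using assms(3) by (auto simp: cell_def split: if_splits)
  let ?b = "(dep v, col (dep v) (pos v))" and ?c = "(dep w, col (dep w) (pos w))"
  have bc: "reduce ?b = reduce ?c"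
    using assms(3) True w by (simp add: cell_def min_absorb1)
  have "inbox v ?b" "inbox w ?c"
    using assms(1,2) by (auto simp: inbox_def intro: exI[of _ "pos v"] exI[of _ "pos w"])
  then have "inbox v (reduce ?b)" "inbox w (reduce ?b)"
    using inbox_reduce[of v ?b] inbox_reduce[of w ?c] bc by simp_all
  then show ?thesis
    using True by (intro box_clique[of _ "reduce ?b" _ "reduce ?b"]) (auto simp: reduce_def)
next
  case False
  then have w: "\<not> dep w \<le> l"
    using assms(3) by (auto simp: cell_def split: if_splits)
  let ?f = "\<lambda>x. \<lfloor>2 ^ l * real M * x\<rfloor>"
  have f_div: "?f x div int M = col l x" for x
    using floor_divide_real_eq_div[of "int M" "2 ^ l * real M * x"] M_pos by (simp add: col_def)
  have f_shift: "?f (x + of_int z) = ?f x + 2 ^ l * int M * z" for x z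
  proof -
    have "2 ^ l * real M * (x + of_int z) = 2 ^ l * real M * x + of_int (2 ^ l * int M * z)"
      by (simp add: algebra_simps)
    then show ?thesis
      by (simp only: floor_add_int)
  qed
  have "col l (pos v) mod 2 ^ l = col l (pos w) mod 2 ^ l"
    using assms(3) False w by (simp add: cell_def reduce_def)
  then obtain z where z: "col l (pos v) = col l (pos w) + 2 ^ l * z"
    by (metis mod_eqE mult.commute add.commute diff_add_cancel)
  have "?f (pos v) mod int M = ?f (pos w) mod int M"
    using assms(3) False w M_pos by (simp add: cell_def eq_nat_nat_iff)
  also have "\<dots> = ?f (pos w + of_int z) mod int M"
    unfolding f_shift by (metis mod_mult_self2 mult.assoc mult.commute)
  finally have "?f (pos v) mod int M = ?f (pos w + of_int z) mod int M" .
  moreover have "?f (pos v) div int M = ?f (pos w + of_int z) div int M"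
    unfolding f_div col_shift using z by simp
  ultimately have "?f (pos v) = ?f (pos w + of_int z)"
    by (metis div_mult_mod_eq)
  then show ?thesis
    using low_cell[of v w "pos v" "pos w + of_int z"] assms lift_add_int lift_pos by blast
qed

lemma card_cells:
  "finite (cell ` touched u v) \<and> card (cell ` touched u v) \<le> 12 * card (reduce ` explored u v) * (M + 1)"
proof -
  let ?Q = "reduce ` explored u v"
  let ?A = "(\<Union>b\<in>?Q. nbrs b) \<times> {..M}"
  have "cell ` touched u v \<subseteq> ?A"
  proof
    fix x assume "x \<in> cell ` touched u v"
    then obtain w t c where w: "x = cell w" "w \<in> V" "lift w t" "c \<in> explored u v"
      "boxadj (min (dep w) l, col (min (dep w) l) t) c"
      by (auto simp: touched_def)
    have "reduce (min (dep w) l, col (min (dep w) l) t) \<in> nbrs (reduce c)"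
      using w(5) boxadj_nbrs boxadj_sym by blast
    then have "fst x \<in> nbrs (reduce c)"
      using reduce_col_lift[OF w(3) lift_pos, of "min (dep w) l" 0] by (simp add: w(1) cell_def)
    moreover have "snd x \<le> M"
      using M_pos by (simp add: w(1) cell_def nat_le_iff Suc_le_eq nat_less_iff)
    ultimately show "x \<in> ?A"
      using w(4) by (cases x) auto
  qed
  moreover have "finite ?A"
    by (intro finite_cartesian_product finite_UN_I finite_reduce_explored) auto
  moreover have "card ?A \<le> 12 * card ?Q * (M + 1)"
  proof -
    have "card (\<Union>b\<in>?Q. nbrs b) \<le> (\<Sum>b\<in>?Q. card (nbrs b))"
      by (rule card_UN_le[OF finite_reduce_explored])
    also have "\<dots> \<le> (\<Sum>b\<in>?Q. 12)"
      by (intro sum_mono card_nbrs)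
    also have "\<dots> = 12 * card ?Q"
      by simp
    finally have "card (\<Union>b\<in>?Q. nbrs b) * (M + 1) \<le> 12 * card ?Q * (M + 1)"
      by (rule mult_right_mono) simp
    then show ?thesis
      unfolding card_cartesian_product by simp
  qed
  ultimately show ?thesis
    by (meson card_mono finite_subset le_trans)
qed

lemma relpow_mono: "u \<in> V \<Longrightarrow> m \<le> n \<Longrightarrow> (u, w) \<in> adj ^^ m \<Longrightarrow> (u, w) \<in> adj ^^ n"
proof (induction n)
  case (Suc n)
  show ?case
  proof (cases "m = Suc n")
    case False
    then have w: "(u, w) \<in> adj ^^ n"
      using Suc by simp
    have "w \<in> V"
    proof (cases n)
      case 0
      then show ?thesis using w Suc.prems by simp
    next
      case (Suc k)
      then show ?thesis using w adj_sub by auto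
    qed
    then show ?thesis
      using w adj_refl by auto
  qed (use Suc in simp)
qed simp

text \<open>If \<open>v\<close> is far from \<open>u\<close>, then some shell of distances from \<open>u\<close> meets no cell that touches the
  explored boxes, and colouring by the inside of this shell contradicts \<open>colour_const\<close>.\<close>

lemma dist_le_explored:
  assumes u: "u \<in> V" "v \<in> V" "(u, v) \<in> adj\<^sup>*"
  shows "(u, v) \<in> adj ^^ (8 * (12 * card (reduce ` explored u v) * (M + 1) + 1))"
proof (rule ccontr)
  define C where "C = 12 * card (reduce ` explored u v) * (M + 1)"
  assume "\<not> ?thesis"
  then have far: "(u, v) \<notin> adj ^^ (8 * (C + 1))"
    by (simp add: C_def)
  define B where "B n = {w. (u, w) \<in> adj ^^ n}" for n
  have B_mono: "B m \<subseteq> B n" if "m \<le> n" for m n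
    using relpow_mono[OF u(1) that] by (auto simp: B_def)
  have B_Suc: "x \<in> B (Suc n)" if "w \<in> B n" "(w, x) \<in> adj" for w x n
    using that relpow_Suc_I[of u w n adj x] unfolding B_def by blast
  \<comment> \<open>No cell meets two of these \<open>C + 1\<close> shells: a cell is a clique,
    whereas vertices in different shells are at least two edges apart.\<close>
  have "\<exists>m\<le>C. touched u v \<inter> (B (8 * m + 7) - B (8 * m)) = {}"
  proof (rule ccontr)
    assume "\<not> ?thesis"
    then have "\<forall>m. \<exists>x. m \<le> C \<longrightarrow> x \<in> touched u v \<and> x \<in> B (8 * m + 7) \<and> x \<notin> B (8 * m)"
      by blast
    from choice[OF this] obtain s where
      s': "\<forall>m. m \<le> C \<longrightarrow> s m \<in> touched u v \<and> s m \<in> B (8 * m + 7) \<and> s m \<notin> B (8 * m)" ..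
    have s: "s m \<in> touched u v" "s m \<in> B (8 * m + 7)" "s m \<notin> B (8 * m)" if "m \<le> C" for m
      using s' that by blast+
    have "\<not> inj_on (cell \<circ> s) {..C}"
    proof
      assume "inj_on (cell \<circ> s) {..C}"
      then have "card {..C} = card ((cell \<circ> s) ` {..C})"
        by (rule card_image[symmetric])
      also have "\<dots> \<le> card (cell ` touched u v)"
        using card_cells s by (intro card_mono) auto
      finally show False
        using card_cells[of u v] by (simp add: C_def)
    qed
    then obtain m m' where m: "m \<le> C" "m' \<le> C" "m < m'" "cell (s m) = cell (s m')"
      by (auto simp: inj_on_def) (metis nat_neq_iff)
    then have "(s m, s m') \<in> adj"
      using s[of m] s[of m'] by (intro cell_clique) (auto simp: touched_def)
    then have "s m' \<in> B (Suc (8 * m + 7))"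
      using s[of m] m B_Suc by blast
    then have "s m' \<in> B (8 * m')"
      using B_mono[of "Suc (8 * m + 7)" "8 * m'"] m(3) by auto
    with s[of m'] m show False by blast
  qed
  then obtain m where m: "m \<le> C" "touched u v \<inter> (B (8 * m + 7) - B (8 * m)) = {}"
    by blast
  \<comment> \<open>The radius \<open>8 * m + 4\<close> is at least three edges away from both sides
    of the shell, as \<open>stable\<close> demands.\<close>
  interpret coloured_box_graph V adj dep pos l u v "\<lambda>w. w \<in> B (8 * m + 4)"
  proof
    fix w x y z assume w: "w \<in> touched u v" and e: "(w, x) \<in> adj" "(x, y) \<in> adj" "(y, z) \<in> adj"
    consider "w \<in> B (8 * m)" | "w \<notin> B (8 * m + 7)"
      using m(2) w by blast
    then show "(z \<in> B (8 * m + 4)) = (w \<in> B (8 * m + 4))"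
    proof cases
      case 1
      then have "z \<in> B (Suc (Suc (Suc (8 * m))))"
        using e B_Suc by blast
      then show ?thesis
        using 1 B_mono[of "8 * m" "8 * m + 4"] B_mono[of "Suc (Suc (Suc (8 * m)))" "8 * m + 4"] by auto
    next
      case 2
      have "z \<notin> B (8 * m + 4)"
      proof
        assume "z \<in> B (8 * m + 4)"
        then have "w \<in> B (Suc (Suc (Suc (8 * m + 4))))"
          using e adj_sym B_Suc by blast
        with 2 show False by (simp add: eval_nat_numeral)
      qed
      then show ?thesis
        using 2 B_mono[of "8 * m + 4" "8 * m + 7"] by auto
    qed
  qed (use u in auto)
  have "u \<in> B (8 * m + 4)"
    using B_mono[of 0 "8 * m + 4"] by (auto simp: B_def)
  moreover have "v \<notin> B (8 * m + 4)"
    using far B_mono[of "8 * m + 4" "8 * (C + 1)"] m(1) by (auto simp: B_def)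
  ultimately show False
    using colour_const[OF u(3)] by blast
qed

theorem dist_le_or_empty_walk:
  assumes "u \<in> V" "v \<in> V" "(u, v) \<in> adj\<^sup>*"
  shows "(u, v) \<in> adj ^^ (8 * (12 * m * (M + 1) + 1)) \<or> (\<exists>xs F. empty_walk m xs F)"
proof (cases "Suc m \<le> card (reduce ` explored u v)")
  case True
  then show ?thesis
    using empty_walk_exists by blast
next
  case False
  then have "12 * card (reduce ` explored u v) * (M + 1) \<le> 12 * m * (M + 1)"
    by (intro mult_right_mono mult_left_mono) auto
  then show ?thesis
    using relpow_mono[OF assms(1) _ dist_le_explored[OF assms], of "8 * (12 * m * (M + 1) + 1)"] by simp
qed

end

section \<open>Components and diameters\<close>

text \<open>By symmetry of the arcs, the vertices reachable from \<open>u\<close> induce a connected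
  subgraph that contains \<open>H\<close>, and \<open>H\<close> is maximal.\<close>

lemma (in sym_digraph) component_eq_induced:
  assumes "max_subgraph connected H" "u \<in> verts H"
  shows "H = G \<restriction> {v. u \<rightarrow>\<^sup>* v}"
proof -
  let ?C = "G \<restriction> {v. u \<rightarrow>\<^sup>* v}"
  have sub: "subgraph H G" and conn: "connected H"
    using assms by (auto simp: max_subgraph_def)
  interpret H: wf_digraph H
    using sub by blast
  have uG: "u \<in> verts G"
    using sub assms(2) by blast
  have C: "?C \<in> sccs"
    using induce_reachable_is_in_sccs[OF uG] .
  then have C': "subgraph ?C G" "strongly_connected ?C"
    by (auto elim!: in_sccsE dest: induced_imp_subgraph)
  interpret C: wf_digraph ?C
    by (rule wellformed_induce_subgraph)
  have C_conn: "connected ?C"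
    using C'(2) C.reachable_mk_symmetricI by (intro C.connectedI) (simp_all add: strongly_connected_def)
  have reach: "u \<rightarrow>\<^sup>* v" if v: "v \<in> verts H" for v
  proof -
    have "u \<rightarrow>\<^sup>*\<^bsub>mk_symmetric H\<^esub> v"
      using conn assms(2) v by (auto simp: connected_def strongly_connected_def)
    then show ?thesis
      unfolding reachable_def
    proof (induction rule: rtrancl_on_induct)
      case base
      then show ?case using uG by (simp add: rtrancl_on_refl)
    next
      case (step x y)
      then obtain e where e: "e \<in> arcs H" "x = tail H e \<and> y = head H e \<or> y = tail H e \<and> x = head H e"
        by (auto simp: parcs_mk_symmetric)
      have "e \<in> arcs G" "tail H e = tail G e" "head H e = head G e"
        using sub e(1) by (auto simp: subgraph_def compatible_def)
      then have "x \<rightarrow>\<^bsub>G\<^esub> y"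
        using e(2) sym_arcs unfolding symmetric_def sym_def by (metis in_arcs_imp_in_arcs_ends)
      moreover have "u \<rightarrow>\<^sup>* x"
        using step by (simp add: reachable_def)
      ultimately show ?case
        using reachable_adj_trans unfolding reachable_def by blast
    qed
  qed
  have "subgraph H ?C"
  proof (rule subgraphI)
    show "verts H \<subseteq> verts ?C"
      using reach by auto
    show "arcs H \<subseteq> arcs ?C"
    proof
      fix e assume e: "e \<in> arcs H"
      then have "e \<in> arcs G" "tail H e = tail G e" "head H e = head G e"
        using sub by (auto simp: subgraph_def compatible_def)
      then show "e \<in> arcs ?C"
        using reach H.wellformed[OF e] by auto
    qed
    show "compatible ?C H"
      using sub by (auto simp: subgraph_def compatible_def)
    show "wf_digraph H" ..
    show "wf_digraph ?C" by (rule wellformed_induce_subgraph)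
  qed
  then show ?thesis
    using assms(1) C'(1) C_conn unfolding max_subgraph_def by metis
qed

context hyp_points
begin

lemma parcs_hadj:
  assumes "R = kpkvb_radius \<nu> n"
  shows "parcs (kpkvb_graph \<nu> n X) = {(i, j) \<in> hadj. i \<noteq> j}"
  by (auto simp: kpkvb_graph_def hadj_def assms[symmetric])

text \<open>Distances are measured inside \<open>H\<close>. As \<open>H\<close> is induced on a full
  reachability class, walks of the graph from a vertex of \<open>H\<close> stay in it; loops of
  \<open>hadj\<close> are dropped.\<close>

lemma component_diameter_le:
  assumes R: "R = kpkvb_radius \<nu> n"
    and H: "H \<in> graph_components (with_proj (kpkvb_graph \<nu> n X))"
    and dist: "\<And>u v. u < n \<Longrightarrow> v < n \<Longrightarrow> (u, v) \<in> hadj\<^sup>* \<Longrightarrow> (u, v) \<in> hadj ^^ K"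
  shows "graph_diameter H \<le> ereal (real K)"
proof -
  interpret pair_graph "kpkvb_graph \<nu> n X"
    by (rule pair_graph_kpkvb_graph)
  let ?G = "with_proj (kpkvb_graph \<nu> n X)"
  have H': "max_subgraph connected H"
    using H by (simp add: graph_components_def)
  then have sub: "subgraph H ?G"
    by (simp add: max_subgraph_def)
  interpret H: wf_digraph H
    using sub by blast
  have "graph_dist H u v \<le> ereal (real K)" if uv: "u \<in> verts H" "v \<in> verts H" for u v
  proof -
    have eq: "H = ?G \<restriction> {v. u \<rightarrow>\<^sup>*\<^bsub>?G\<^esub> v}"
      using component_eq_induced[OF H' uv(1)] .
    have arc: "(x, y) \<in> arcs H \<and> y \<in> verts H \<and> tail H (x, y) = x \<and> head H (x, y) = y"
      if "x \<in> verts H" "(x, y) \<in> hadj" "x \<noteq> y" for x y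
    proof -
      have a: "(x, y) \<in> parcs (kpkvb_graph \<nu> n X)"
        using that by (simp add: parcs_hadj[OF R])
      have x: "u \<rightarrow>\<^sup>*\<^bsub>?G\<^esub> x"
        using that(1) by (subst (asm) eq) simp
      have y: "u \<rightarrow>\<^sup>*\<^bsub>?G\<^esub> y"
        using reachable_adj_trans[OF x] a by simp
      show ?thesis
        unfolding eq using a x y by simp
    qed
    have walk: "(u, x) \<in> hadj ^^ k \<Longrightarrow> \<exists>p. H.awalk u p x \<and> length p \<le> k" for k x
    proof (induction k arbitrary: x)
      case 0
      then show ?case
        using uv by (intro exI[of _ "[]"]) (simp add: H.awalk_Nil_iff)
    next
      case (Suc k)
      then obtain y where y: "(u, y) \<in> hadj ^^ k" "(y, x) \<in> hadj"
        by auto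
      obtain p where p: "H.awalk u p y" "length p \<le> k"
        using Suc.IH[OF y(1)] by blast
      show ?case
      proof (cases "y = x")
        case True
        then show ?thesis
          using p by (metis le_SucI)
      next
        case False
        have yH: "y \<in> verts H"
          using p(1) by blast
        have "H.awalk y [(y, x)] x"
          using arc[OF yH y(2) False] H.arc_implies_awalk[of "(y, x)"] by simp
        then have "H.awalk u (p @ [(y, x)]) x"
          using p(1) H.awalk_appendI by blast
        then show ?thesis
          using p(2) by (intro exI[of _ "p @ [(y, x)]"]) simp
      qed
    qed
    have uvn: "u < n" "v < n"
      using sub uv by (auto simp: subgraph_def kpkvb_graph_def)
    have "u \<rightarrow>\<^sup>*\<^bsub>?G\<^esub> v"
      using uv(2) by (subst (asm) eq) simp
    then have "(u, v) \<in> (parcs (kpkvb_graph \<nu> n X))\<^sup>*"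
      unfolding reachable_def by (auto dest: rtrancl_on_rtranclI)
    then have "(u, v) \<in> hadj\<^sup>*"
      by (rule rtrancl_mono[THEN subsetD, rotated]) (auto simp: parcs_hadj[OF R])
    then obtain p where p: "H.awalk u p v" "length p \<le> K"
      using walk dist uvn by blast
    have "graph_dist H u v \<le> ereal (H.awalk_cost (\<lambda>_. 1) p)"
      unfolding graph_dist_def by (rule H.min_cost_le_walk_cost[OF p(1)])
    also have "H.awalk_cost (\<lambda>_. 1) p = real (length p)"
      unfolding H.awalk_cost_def by (induction p) simp_all
    finally show ?thesis
      using p(2) by (meson ereal_less_eq(3) of_nat_le_iff order_trans)
  qed
  then show ?thesis
    unfolding graph_diameter_def by (intro SUP_least)
qed

lemma hyp_cell_graph:
  assumes "0 < M" "5 * exp (R / 2) \<le> 2 ^ l * real M"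
  shows "cell_graph {..<n} hadj hdep hpos l M"
proof
  fix v w s t assume a: "v \<in> {..<n}" "w \<in> {..<n}" "lift v s" "lift w t" "\<lfloor>2 ^ l * real M * s\<rfloor> = \<lfloor>2 ^ l * real M * t\<rfloor>"
  have "\<bar>2 ^ l * real M * s - 2 ^ l * real M * t\<bar> \<le> 1"
    using a(5) by linarith
  moreover have "2 ^ l * real M * s - 2 ^ l * real M * t = 2 ^ l * real M * (s - t)"
    by (simp add: algebra_simps)
  ultimately have "2 ^ l * real M * \<bar>s - t\<bar> \<le> 1"
    by (simp add: abs_mult)
  moreover have "5 * exp (R / 2) * \<bar>s - t\<bar> \<le> 2 ^ l * real M * \<bar>s - t\<bar>"
    using assms(2) by (rule mult_right_mono) simp
  ultimately have "\<bar>s - t\<bar> * exp (R / 2) \<le> 1 / 5"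
    by (simp add: mult.commute)
  then show "(v, w) \<in> hadj"
    using a by (intro low_clique) auto
qed (use assms in auto)

lemma diameter_le_or_empty_walk:
  assumes "R = kpkvb_radius \<nu> n" "0 < M" "5 * exp (R / 2) \<le> 2 ^ l * real M"
  shows "(\<forall>H\<in>graph_components (with_proj (kpkvb_graph \<nu> n X)).
      graph_diameter H \<le> ereal (real (8 * (12 * m * (M + 1) + 1)))) \<or> (\<exists>xs F. empty_walk m xs F)"
proof (cases "\<exists>xs F. empty_walk m xs F")
  case False
  interpret cell_graph "{..<n}" hadj hdep hpos l M
    using hyp_cell_graph assms by blast
  show ?thesis
    using component_diameter_le[OF assms(1)] dist_le_or_empty_walk[of _ _ m] False by blast
qed simp

end

section \<open>The probability of empty boxes\<close>

text \<open>For the root box this is only an outer annulus of the disk, which suffices for a lower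
  bound on the chance of being nonempty. The angles run backwards as in \<open>hpos\<close>.\<close>

definition region :: "real \<Rightarrow> box \<Rightarrow> (real \<times> real) set" where
  "region R b = {outer R (fst b) - ln 2<..outer R (fst b)}
     \<times> {pi - 2 * pi * (of_int (snd b) + 1) / 2 ^ fst b<..pi - 2 * pi * of_int (snd b) / 2 ^ fst b}"

lemma depth_col_region:
  assumes "p \<in> region R b"
  shows "(depth R (fst p), col (depth R (fst p)) ((pi - snd p) / (2 * pi))) = b"
proof -
  obtain d k where b: "b = (d, k)"
    by (cases b)
  obtain r \<theta> where p: "p = (r, \<theta>)"
    by (cases p)
  have r: "outer R d - ln 2 < r" "r \<le> outer R d"
    and th: "pi - 2 * pi * (of_int k + 1) / 2 ^ d < \<theta>" "\<theta> \<le> pi - 2 * pi * of_int k / 2 ^ d"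
    using assms by (auto simp: b p region_def)
  have "d \<le> depth R r"
  proof (cases d)
    case (Suc e)
    then have "outer R e < r"
      using r by (simp add: outer_def algebra_simps)
    then show ?thesis
      using Suc depth_le_iff[of R r e] by linarith
  qed simp
  then have d: "depth R r = d"
    using r depth_le_iff[of R r d] by simp
  have "2 * pi * of_int k \<le> (pi - \<theta>) * 2 ^ d" "(pi - \<theta>) * 2 ^ d < 2 * pi * (of_int k + 1)"
    using th by (simp_all add: field_simps)
  then have "of_int k \<le> 2 ^ d * ((pi - \<theta>) / (2 * pi))" "2 ^ d * ((pi - \<theta>) / (2 * pi)) < of_int k + 1"
    by (simp_all add: field_simps)
  then have "col d ((pi - \<theta>) / (2 * pi)) = k"
    unfolding col_def by (intro floor_unique) auto
  with d show ?thesis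
    by (simp add: b p)
qed

lemma (in hyp_points) active_of_region:
  assumes "i < n" "X i \<in> region R b"
  shows "active b"
proof -
  have "inbox i b"
    using depth_col_region[OF assms(2)] assms(1)
    by (auto simp: inbox_def hdep_def hpos_def[symmetric] intro!: exI[of _ "hpos i"])
  then show ?thesis
    by (auto simp: active_def)
qed

lemma disjoint_regions: "disjoint_family_on (region R) F"
  unfolding disjoint_family_on_def by (metis depth_col_region disjoint_iff)

lemma sets_kpkvb_point [measurable_cong]: "sets (kpkvb_point \<alpha> R) = sets borel"
  by (simp add: kpkvb_point_def)

lemma space_kpkvb_point [simp]: "space (kpkvb_point \<alpha> R) = UNIV"
  by (simp add: kpkvb_point_def)

lemma kpkvb_density_measurable: "(\<lambda>p. ennreal (kpkvb_density \<alpha> R p)) \<in> borel_measurable lborel"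
proof -
  have "kpkvb_density \<alpha> R = (\<lambda>p. if fst p \<in> {0..R} \<and> snd p \<in> {-pi<..pi}
     then 1 / (2 * pi) * (\<alpha> * sinh (\<alpha> * fst p) / (cosh (\<alpha> * R) - 1)) else 0)"
    by (auto simp: kpkvb_density_def fun_eq_iff)
  moreover have [measurable]: "(sinh :: real \<Rightarrow> real) \<in> borel_measurable borel"
    by (intro borel_measurable_continuous_onI continuous_intros)
  ultimately have "(\<lambda>p. ennreal (kpkvb_density \<alpha> R p)) \<in> borel_measurable (lborel \<Otimes>\<^sub>M lborel)"
    by simp
  then show ?thesis
    by (simp only: lborel_prod)
qed

lemma emeasure_kpkvb_point_rectangle:
  assumes "\<alpha> > 0" "R > 0" "0 \<le> a" "a \<le> b" "b \<le> R" "- pi \<le> c" "c \<le> d" "d \<le> pi"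
  shows "emeasure (kpkvb_point \<alpha> R) ({a<..b} \<times> {c<..d})
    = ennreal ((cosh (\<alpha> * b) - cosh (\<alpha> * a)) / (cosh (\<alpha> * R) - 1) * ((d - c) / (2 * pi)))"
proof -
  define q where "q = cosh (\<alpha> * R) - 1"
  have "cosh (\<alpha> * R) > 1"
    using cosh_real_strict_mono[of 0 "\<alpha> * R"] assms by simp
  then have q: "q > 0"
    by (simp add: q_def)
  let ?f = "\<lambda>r. \<alpha> * sinh (\<alpha> * r) / q"
  have nn: "?f r \<ge> 0" if "r \<ge> 0" for r
    using that q assms by simp
  have [measurable]: "?f \<in> borel_measurable borel"
    by (intro borel_measurable_continuous_onI continuous_intros) (use q in auto)
  have 1: "(\<integral>\<^sup>+r. ennreal (?f r) * indicator {a<..b} r \<partial>lborel) = ennreal ((cosh (\<alpha> * b) - cosh (\<alpha> * a)) / q)"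
  proof -
    have "(\<integral>\<^sup>+r. ennreal (?f r) * indicator {a<..b} r \<partial>lborel)
        = (\<integral>\<^sup>+r. ennreal (?f r) * indicator {a..b} r \<partial>lborel)"
      using AE_lborel_singleton[of a] by (intro nn_integral_cong_AE) (auto simp: indicator_def)
    also have "\<dots> = ennreal (cosh (\<alpha> * b) / q - cosh (\<alpha> * a) / q)"
    proof (rule nn_integral_FTC_Icc)
      show "((\<lambda>r. cosh (\<alpha> * r) / q) has_real_derivative ?f x) (at x)" for x
        by (use q in \<open>auto intro!: derivative_eq_intros\<close>)
    qed (use assms nn in auto)
    finally show ?thesis
      by (simp add: diff_divide_distrib)
  qed
  have 2: "(\<integral>\<^sup>+\<theta>. ennreal (1 / (2 * pi)) * indicator {c<..d} \<theta> \<partial>lborel) = ennreal ((d - c) / (2 * pi))"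
    using assms by (simp add: nn_integral_cmult_indicator flip: ennreal_mult)
  have eq: "ennreal (kpkvb_density \<alpha> R (r, \<theta>)) * indicator ({a<..b} \<times> {c<..d}) (r, \<theta>)
      = (ennreal (?f r) * indicator {a<..b} r) * (ennreal (1 / (2 * pi)) * indicator {c<..d} \<theta>)" for r \<theta>
    using nn[of r] assms
    by (auto simp: kpkvb_density_def q_def mult.commute indicator_def simp flip: ennreal_mult)
  have sets: "{a<..b} \<times> {c<..d} \<in> sets lborel"
    by (simp add: borel_prod[symmetric])
  have meas: "(\<lambda>p. ennreal (kpkvb_density \<alpha> R p) * indicator ({a<..b} \<times> {c<..d}) p)
      \<in> borel_measurable (lborel \<Otimes>\<^sub>M lborel)"
    using kpkvb_density_measurable sets by (simp add: lborel_prod)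
  have "emeasure (kpkvb_point \<alpha> R) ({a<..b} \<times> {c<..d})
      = (\<integral>\<^sup>+p. ennreal (kpkvb_density \<alpha> R p) * indicator ({a<..b} \<times> {c<..d}) p \<partial>(lborel \<Otimes>\<^sub>M lborel))"
    unfolding kpkvb_point_def lborel_prod by (rule emeasure_density[OF kpkvb_density_measurable sets])
  also have "\<dots> = (\<integral>\<^sup>+r. (\<integral>\<^sup>+\<theta>. ennreal (kpkvb_density \<alpha> R (r, \<theta>)) * indicator ({a<..b} \<times> {c<..d}) (r, \<theta>) \<partial>lborel) \<partial>lborel)"
    using meas by (rule lborel.nn_integral_fst[symmetric])
  also have "\<dots> = ennreal ((cosh (\<alpha> * b) - cosh (\<alpha> * a)) / q) * ennreal ((d - c) / (2 * pi))"
    unfolding eq by (subst nn_integral_cmult) (simp_all add: 1 2 nn_integral_multc)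
  also have "\<dots> = ennreal ((cosh (\<alpha> * b) - cosh (\<alpha> * a)) / q * ((d - c) / (2 * pi)))"
    using assms q by (intro ennreal_mult[symmetric]) (auto simp: cosh_real_nonneg_le_iff)
  finally show ?thesis
    by (simp add: q_def)
qed

lemma AE_kpkvb_point_radius: "AE p in kpkvb_point \<alpha> R. fst p \<in> {0..R}"
  unfolding kpkvb_point_def AE_density[OF kpkvb_density_measurable]
  by (auto simp: kpkvb_density_def split: if_splits)

lemma prob_avoid:
  assumes "prob_space P" "A \<in> sets P"
  shows "measure (\<Pi>\<^sub>M i\<in>{..<N}. P) {X \<in> space (\<Pi>\<^sub>M i\<in>{..<N}. P). \<forall>i<N. X i \<notin> A} \<le> exp (- (real N * measure P A))"
proof -
  interpret prob_space P by fact
  interpret finite_product_prob_space "\<lambda>_. P" "{..<N}"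
    by unfold_locales simp
  have "{X \<in> space (\<Pi>\<^sub>M i\<in>{..<N}. P). \<forall>i<N. X i \<notin> A} = (\<Pi>\<^sub>E i\<in>{..<N}. space P - A)"
    by (auto simp: space_PiM PiE_def Pi_def)
  then have "measure (\<Pi>\<^sub>M i\<in>{..<N}. P) {X \<in> space (\<Pi>\<^sub>M i\<in>{..<N}. P). \<forall>i<N. X i \<notin> A} = (1 - measure P A) ^ N"
    using assms(2) prob_times[of "\<lambda>_. space P - A"] prob_space.prob_compl[OF assms] by simp
  also have "\<dots> \<le> exp (- measure P A) ^ N"
    using exp_ge_add_one_self[of "- measure P A"] prob_space.prob_le_1[OF assms(1), of A] by (intro power_mono) auto
  also have "\<dots> = exp (- (real N * measure P A))"
    by (simp add: exp_of_nat_mult[symmetric])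
  finally show ?thesis .
qed

lemma region_sets: "region R b \<in> sets (kpkvb_point \<alpha> R')"
  by (simp add: sets_kpkvb_point region_def borel_prod[symmetric])

text \<open>Emptiness of different regions is not independent. But all points avoid the union, and
  as the regions are disjoint, their measures add up in the exponent.\<close>

lemma prob_regions_empty:
  assumes "\<alpha> > 0" "R > 0" "finite F" "\<And>b. b \<in> F \<Longrightarrow> \<kappa> \<le> real N * measure (kpkvb_point \<alpha> R) (region R b)"
  shows "measure (\<Pi>\<^sub>M i\<in>{..<N}. kpkvb_point \<alpha> R)
      {X \<in> space (\<Pi>\<^sub>M i\<in>{..<N}. kpkvb_point \<alpha> R). \<forall>b\<in>F. \<forall>i<N. X i \<notin> region R b} \<le> exp (- (\<kappa> * real (card F)))"
proof -
  interpret prob_space "kpkvb_point \<alpha> R"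
    by (rule prob_space_kpkvb_point[OF assms(1,2)])
  have "\<kappa> * real (card F) = (\<Sum>b\<in>F. \<kappa>)"
    by simp
  also have "\<dots> \<le> (\<Sum>b\<in>F. real N * prob (region R b))"
    using assms(4) by (rule sum_mono)
  also have "\<dots> = real N * prob (\<Union>b\<in>F. region R b)"
    using region_sets disjoint_regions assms(3)
    by (subst finite_measure_finite_Union) (auto simp: sum_distrib_left)
  finally have e1: "exp (- (real N * prob (\<Union>b\<in>F. region R b))) \<le> exp (- (\<kappa> * real (card F)))"
    by simp
  have e2: "measure (\<Pi>\<^sub>M i\<in>{..<N}. kpkvb_point \<alpha> R)
      {X \<in> space (\<Pi>\<^sub>M i\<in>{..<N}. kpkvb_point \<alpha> R). \<forall>i<N. X i \<notin> (\<Union>b\<in>F. region R b)}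
      \<le> exp (- (real N * prob (\<Union>b\<in>F. region R b)))"
    using region_sets assms(3) by (intro prob_avoid prob_space_axioms) auto
  have e3: "{X \<in> space (\<Pi>\<^sub>M i\<in>{..<N}. kpkvb_point \<alpha> R). \<forall>i<N. X i \<notin> (\<Union>b\<in>F. region R b)}
      = {X \<in> space (\<Pi>\<^sub>M i\<in>{..<N}. kpkvb_point \<alpha> R). \<forall>b\<in>F. \<forall>i<N. X i \<notin> region R b}"
    by blast
  show ?thesis
    using order_trans[OF e2 e1] unfolding e3 .
qed

text \<open>At outer radius \<open>y\<close> a box has mass of order
  \<open>exp ((1 - \<alpha>) * (R - y) - R / 2)\<close>, so the bound is worst at
  \<open>y = R - h\<close>. The constant is \<open>6000 = 5 * 1200\<close>, with 1200 from
  \<open>inner_radius\<close>.\<close>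

lemma measure_region_ge:
  assumes \<alpha>: "1 / 2 \<le> \<alpha>" "\<alpha> \<le> 1" and R: "2 * ln 1200 + 20 \<le> R" "0 \<le> h" "outer R l \<le> R - h"
    and b: "fst b \<le> l" "snd b \<in> {0..<2 ^ fst b}"
  shows "exp (- (R / 2)) * exp ((1 - \<alpha>) * h) / 6000 \<le> measure (kpkvb_point \<alpha> R) (region R b)"
proof -
  obtain d k where dk: "b = (d, k)" by (cases b)
  define y where "y = outer R d"
  have "0 \<le> ln (1200::real)"
    by (rule ln_ge_zero) simp
  then have R20: "20 \<le> R" and in10: "10 \<le> inner_radius R"
    using R unfolding inner_radius_def by linarith+
  have y: "10 \<le> y" "y \<le> R - h" "y \<le> R"
  proof -
    have "outer R d \<le> outer R l"
      using outer_mono b(1) by (simp add: dk)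
    then show "y \<le> R - h" "y \<le> R"
      using R by (simp_all add: y_def)
    have "inner_radius R \<le> outer R d"
      by (simp add: outer_def)
    then show "10 \<le> y"
      using in10 by (simp add: y_def)
  qed
  have ln2: "0 < ln (2::real)" "ln (2::real) \<le> 1"
    using ln_le_minus_one[of 2] by simp_all
  have k: "0 \<le> k" "k + 1 \<le> 2 ^ d"
    using b by (auto simp: dk)
  have kr: "0 \<le> real_of_int k / 2 ^ d" "(real_of_int k + 1) / 2 ^ d \<le> 1"
  proof -
    have "real_of_int (k + 1) \<le> real_of_int (2 ^ d)"
      using k(2) by (simp only: of_int_le_iff)
    then show "0 \<le> real_of_int k / 2 ^ d" "(real_of_int k + 1) / 2 ^ d \<le> 1"
      using k(1) by (simp_all add: field_simps)
  qed
  have "emeasure (kpkvb_point \<alpha> R) (region R b)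
    = ennreal ((cosh (\<alpha> * y) - cosh (\<alpha> * (y - ln 2))) / (cosh (\<alpha> * R) - 1)
      * ((pi - 2 * pi * of_int k / 2 ^ d - (pi - 2 * pi * (of_int k + 1) / 2 ^ d)) / (2 * pi)))"
    unfolding region_def dk fst_conv snd_conv y_def[symmetric]
  proof (rule emeasure_kpkvb_point_rectangle)
    have "2 * pi * ((real_of_int k + 1) / 2 ^ d) \<le> 2 * pi * 1"
      using kr by (intro mult_left_mono) auto
    then show "- pi \<le> pi - 2 * pi * (real_of_int k + 1) / 2 ^ d"
      by simp
    have "2 * pi * (real_of_int k / 2 ^ d) \<le> 2 * pi * ((real_of_int k + 1) / 2 ^ d)"
      by (intro mult_left_mono divide_right_mono) auto
    then show "pi - 2 * pi * (real_of_int k + 1) / 2 ^ d \<le> pi - 2 * pi * real_of_int k / 2 ^ d"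
      by simp
    have "0 \<le> 2 * pi * (real_of_int k / 2 ^ d)"
      using kr by (intro mult_nonneg_nonneg) auto
    then show "pi - 2 * pi * real_of_int k / 2 ^ d \<le> pi"
      by simp
  qed (use \<alpha> y ln2 R20 in auto)
  also have "(pi - 2 * pi * of_int k / 2 ^ d - (pi - 2 * pi * (of_int k + 1) / 2 ^ d)) / (2 * pi) = 1 / 2 ^ d"
    by (simp add: field_simps)
  finally have em: "emeasure (kpkvb_point \<alpha> R) (region R b)
    = ennreal ((cosh (\<alpha> * y) - cosh (\<alpha> * (y - ln 2))) / (cosh (\<alpha> * R) - 1) * (1 / 2 ^ d))" .
  have ay: "5 \<le> \<alpha> * y"
    using mult_mono[of "1 / 2" \<alpha> 10 y] \<alpha> y by simp
  have num: "exp (\<alpha> * y) / 10 \<le> cosh (\<alpha> * y) - cosh (\<alpha> * (y - ln 2))"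
  proof -
    have "exp (\<alpha> * (y - ln 2)) = exp (\<alpha> * y) * exp (- (\<alpha> * ln 2))"
      by (simp add: exp_add[symmetric] algebra_simps)
    \<comment> \<open>As \<alpha> is at least 1/2, the factor is at most the inverse square root of
      2, which is below \<open>71 / 100\<close>.\<close>
    also have "exp (- (\<alpha> * ln 2)) \<le> exp (- (1 / 2 * ln (2::real)))"
      using \<alpha> ln2 by simp
    also have "exp (- (1 / 2 * ln (2::real))) \<le> (71 / 100)"
    proof -
      have "(exp (- (1 / 2 * ln (2::real))))\<^sup>2 = exp (- ln 2)"
        by (simp add: exp_double[symmetric])
      also have "\<dots> \<le> (71 / 100)\<^sup>2"
        by (simp add: exp_minus power2_eq_square)
      finally show ?thesis
        by (rule power2_le_imp_le) simp
    qed
    finally have 1: "exp (\<alpha> * (y - ln 2)) \<le> (71 / 100) * exp (\<alpha> * y)"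
      by simp
    have "exp (- (\<alpha> * (y - ln 2))) \<le> 1"
      using \<alpha> y ln2 by simp
    moreover have "32 \<le> exp (\<alpha> * y)"
    proof -
      have "(2::real) ^ 5 \<le> exp 1 ^ 5"
        using exp_ge_add_one_self[of 1] by (intro power_mono) auto
      also have "\<dots> = exp 5"
        by (simp add: exp_of_nat_mult[symmetric])
      also have "\<dots> \<le> exp (\<alpha> * y)"
        using ay by simp
      finally show ?thesis by simp
    qed
    moreover have "0 < exp (- (\<alpha> * y))"
      by simp
    ultimately show ?thesis
      using 1 unfolding cosh_field_def add_divide_distrib by linarith
  qed
  have num0: "0 \<le> cosh (\<alpha> * y) - cosh (\<alpha> * (y - ln 2))"
    by (rule order_trans[OF _ num]) simp
  have den: "cosh (\<alpha> * R) - 1 \<le> exp (\<alpha> * R) / 2"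
  proof -
    have "exp (- (\<alpha> * R)) \<le> 1"
      using \<alpha> R20 by simp
    then show ?thesis
      unfolding cosh_field_def add_divide_distrib by linarith
  qed
  have den0: "0 < cosh (\<alpha> * R) - 1"
    using cosh_real_strict_mono[of 0 "\<alpha> * R"] \<alpha> R20 by simp
  have pow: "1 / 2 ^ d = exp (inner_radius R - y)"
  proof -
    have "exp (y - inner_radius R) = 2 ^ d"
      by (simp add: y_def outer_def exp_of_nat_mult)
    then show ?thesis
      by (metis exp_minus inverse_eq_divide minus_diff_eq)
  qed
  have "exp (- (R / 2)) * exp ((1 - \<alpha>) * h) / 6000 = exp (- (R / 2) - ln 1200 + (1 - \<alpha>) * h) / 5"
    by (simp add: exp_add exp_diff)
  also have "- (R / 2) - ln 1200 + (1 - \<alpha>) * h \<le> \<alpha> * y - \<alpha> * R + (inner_radius R - y)"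
  proof -
    have "(1 - \<alpha>) * y \<le> (1 - \<alpha>) * (R - h)"
      using \<alpha> y by (intro mult_left_mono) auto
    then show ?thesis
      by (simp add: inner_radius_def algebra_simps)
  qed
  also have "exp (\<alpha> * y - \<alpha> * R + (inner_radius R - y)) / 5
      = exp (\<alpha> * y) / 10 / (exp (\<alpha> * R) / 2) * (1 / 2 ^ d)"
    unfolding pow by (simp add: exp_add exp_diff)
  also have "\<dots> \<le> (cosh (\<alpha> * y) - cosh (\<alpha> * (y - ln 2))) / (cosh (\<alpha> * R) - 1) * (1 / 2 ^ d)"
    using num num0 den den0 by (intro mult_right_mono frac_le) auto
  also have "\<dots> = measure (kpkvb_point \<alpha> R) (region R b)"
    using em num0 den0 unfolding measure_def by simp
  finally show ?thesis
    by simp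
qed

text \<open>There are finitely many graphs on \<open>N\<close> vertices, and each is prescribed by
  finitely many measurable conditions, so every property of the graph is an event.\<close>

lemma sets_kpkvb_points_graph:
  "{X \<in> space (kpkvb_points \<alpha> \<nu> N). Q (kpkvb_graph \<nu> N X)} \<in> sets (kpkvb_points \<alpha> \<nu> N)"
proof -
  let ?M = "kpkvb_points \<alpha> \<nu> N" and ?R = "kpkvb_radius \<nu> N"
  let ?E = "\<lambda>A i j. {X \<in> space ?M. ((i, j) \<in> A) = (i \<noteq> j \<and> hyp_dist (X i) (X j) \<le> ?R)}"
  have comp: "(\<lambda>X. X i) \<in> ?M \<rightarrow>\<^sub>M borel" if "i < N" for i
  proof -
    have "(\<lambda>X. X i) \<in> ?M \<rightarrow>\<^sub>M kpkvb_point \<alpha> ?R"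
      unfolding kpkvb_points_def using that by (intro measurable_component_singleton) auto
    then show ?thesis
      by (simp add: measurable_cong_sets[OF refl sets_kpkvb_point])
  qed
  have fst': "(\<lambda>X. fst (X i)) \<in> borel_measurable ?M" and snd': "(\<lambda>X. snd (X i)) \<in> borel_measurable ?M"
    if "i < N" for i
  proof -
    have *: "(fst :: real \<times> real \<Rightarrow> real) \<in> borel_measurable borel" "(snd :: real \<times> real \<Rightarrow> real) \<in> borel_measurable borel"
      by (intro borel_measurable_continuous_onI continuous_on_fst continuous_on_snd continuous_on_id)+
    show "(\<lambda>X. fst (X i)) \<in> borel_measurable ?M" "(\<lambda>X. snd (X i)) \<in> borel_measurable ?M"
      by (rule measurable_compose[OF comp[OF that]], rule *)+
  qed
  have E: "?E A i j \<in> sets ?M" if "i < N" "j < N" for A i j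
  proof -
    note [measurable] = fst'[OF that(1)] fst'[OF that(2)] snd'[OF that(1)] snd'[OF that(2)]
    have [measurable]: "(sinh :: real \<Rightarrow> real) \<in> borel_measurable borel" "(cosh :: real \<Rightarrow> real) \<in> borel_measurable borel"
      by (intro borel_measurable_continuous_onI continuous_on_sinh continuous_on_cosh continuous_on_id)+
    have "hyp_dist p q = arcosh (cosh (fst p) * cosh (fst q) - sinh (fst p) * sinh (fst q) * cos (snd p - snd q))" for p q
      by (simp add: hyp_dist_def split_def)
    then have [measurable]: "(\<lambda>X. hyp_dist (X i) (X j)) \<in> borel_measurable ?M"
      by (simp add: arcosh_def)
    show ?thesis
      by measurable
  qed
  let ?A = "{A. A \<subseteq> {..<N} \<times> {..<N} \<and> Q \<lparr>pverts = {..<N}, parcs = A\<rparr>}"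
  have fin: "finite ?A"
    by (rule finite_subset[of _ "Pow ({..<N} \<times> {..<N})"]) auto
  have "{X \<in> space ?M. Q (kpkvb_graph \<nu> N X)}
      = (\<Union>A\<in>?A. {X \<in> space ?M. \<forall>i\<in>{..<N}. \<forall>j\<in>{..<N}. ((i, j) \<in> A) = (i \<noteq> j \<and> hyp_dist (X i) (X j) \<le> ?R)})"
    (is "?L = ?U")
  proof
    show "?L \<subseteq> ?U"
    proof
      fix X assume X: "X \<in> ?L"
      then have "parcs (kpkvb_graph \<nu> N X) \<in> ?A"
        by (auto simp: kpkvb_graph_def)
      then show "X \<in> ?U"
        by (rule UN_I) (use X in \<open>auto simp: kpkvb_graph_def\<close>)
    qed
    show "?U \<subseteq> ?L"
    proof
      fix X assume "X \<in> ?U"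
      then obtain A where A: "A \<subseteq> {..<N} \<times> {..<N}" "Q \<lparr>pverts = {..<N}, parcs = A\<rparr>" "X \<in> space ?M"
        and *: "\<forall>i\<in>{..<N}. \<forall>j\<in>{..<N}. ((i, j) \<in> A) = (i \<noteq> j \<and> hyp_dist (X i) (X j) \<le> ?R)"
        by blast
      have "A = {(i, j). i < N \<and> j < N \<and> i \<noteq> j \<and> hyp_dist (X i) (X j) \<le> ?R}"
        using A(1) * by auto
      then show "X \<in> ?L"
        using A by (simp add: kpkvb_graph_def)
    qed
  qed
  moreover have "?U \<in> sets ?M"
    by (rule sets.finite_UN[OF fin], rule sets.sets_Collect_finite_All, rule sets.sets_Collect_finite_All, rule E) simp_all
  ultimately show ?thesis
    by simp
qed

text \<open>A union bound over the walks of length \<open>2 * m\<close> and the sets of empty boxes on them; each box is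
  expected to contain at least \<open>192000 / 6000 = 32\<close> points.\<close>

lemma prob_diameter_le:
  assumes \<alpha>: "1 / 2 \<le> \<alpha>" "\<alpha> \<le> 1" and \<nu>: "0 < \<nu>" and N: "0 < N"
    and R: "R = kpkvb_radius \<nu> N" "2 * ln 1200 + 20 \<le> R" and h: "0 \<le> h" "outer R l \<le> R - h"
    and M: "0 < M" "5 * exp (R / 2) \<le> 2 ^ l * real M"
    and big: "192000 \<le> \<nu> * exp ((1 - \<alpha>) * h)" and m: "m = 12 * (l + 1)"
  shows "\<P>(X in kpkvb_points \<alpha> \<nu> N. \<forall>H\<in>graph_components (with_proj (kpkvb_graph \<nu> N X)).
      graph_diameter H \<le> ereal (real (8 * (12 * m * (M + 1) + 1)))) \<ge> 1 - 2 * (1 / 2) ^ m"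
proof -
  let ?P = "kpkvb_point \<alpha> R" and ?M = "kpkvb_points \<alpha> \<nu> N"
  let ?D = "\<lambda>X. \<forall>H\<in>graph_components (with_proj (kpkvb_graph \<nu> N X)).
      graph_diameter H \<le> ereal (real (8 * (12 * m * (M + 1) + 1)))"
  have "0 \<le> ln (1200::real)"
    by (rule ln_ge_zero) simp
  then have R0: "0 < R"
    using R by linarith
  have M_def: "?M = (\<Pi>\<^sub>M i\<in>{..<N}. ?P)"
    by (simp add: kpkvb_points_def R)
  have P: "prob_space ?P"
    using prob_space_kpkvb_point \<alpha> R0 by simp
  interpret prob_space ?M
    unfolding M_def by (intro prob_space_PiM P)
  define bad where "bad F = {X \<in> space ?M. \<forall>b\<in>F. \<forall>i<N. X i \<notin> region R b}" for F
  define \<F> where "\<F> xs = {F. F \<subseteq> set xs \<and> m \<le> card F + 6 * (l + 1)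
     \<and> (\<forall>b\<in>F. fst b \<le> l \<and> snd b \<in> {0..<2 ^ fst b})}" for xs :: "box list"
  have fin: "finite (\<F> xs)" "card (\<F> xs) \<le> 2 ^ length xs" "F \<in> \<F> xs \<Longrightarrow> finite F" for xs F
  proof -
    have sub: "\<F> xs \<subseteq> Pow (set xs)"
      by (auto simp: \<F>_def)
    then show "finite (\<F> xs)"
      by (rule finite_subset) simp
    have "card (\<F> xs) \<le> card (Pow (set xs))"
      using sub by (intro card_mono) auto
    also have "\<dots> \<le> 2 ^ length xs"
      by (simp add: card_Pow card_length)
    finally show "card (\<F> xs) \<le> 2 ^ length xs" .
    show "F \<in> \<F> xs \<Longrightarrow> finite F"
      by (auto simp: \<F>_def intro: finite_subset)
  qed
  have bad_sets: "bad F \<in> sets ?M" if "finite F" for F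
  proof -
    have "{X \<in> space ?M. X i \<notin> region R b} \<in> sets ?M" if "i < N" for i b
    proof -
      have 1: "(\<lambda>X. X i) \<in> ?M \<rightarrow>\<^sub>M ?P"
        unfolding M_def using that by (intro measurable_component_singleton) auto
      have "(\<lambda>X. X i) -` (space ?P - region R b) \<inter> space ?M \<in> sets ?M"
        by (intro measurable_sets[OF 1] sets.compl_sets region_sets)
      then show ?thesis
        by (simp add: vimage_def Int_def conj_commute)
    qed
    then have "{X \<in> space ?M. \<forall>b\<in>F. \<forall>i\<in>{..<N}. X i \<notin> region R b} \<in> sets ?M"
      using that by (intro sets.sets_Collect_finite_All) auto
    moreover have "bad F = {X \<in> space ?M. \<forall>b\<in>F. \<forall>i\<in>{..<N}. X i \<notin> region R b}"
      unfolding bad_def by blast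
    ultimately show ?thesis
      by (simp only:)
  qed
  have bad_prob: "prob (bad F) \<le> exp (- (16 * real m))" if "F \<in> \<F> xs" for F xs
  proof -
    have "32 \<le> real N * measure ?P (region R b)" if "b \<in> F" for b
    proof -
      have e: "exp (- (R / 2)) = \<nu> / real N"
        using \<nu> N by (simp add: R kpkvb_radius_def exp_minus)
      have "192000 / real N / 6000 \<le> \<nu> * exp ((1 - \<alpha>) * h) / real N / 6000"
        using big by (intro divide_right_mono) auto
      then have "32 / real N \<le> exp (- (R / 2)) * exp ((1 - \<alpha>) * h) / 6000"
        unfolding e by simp
      also have "exp (- (R / 2)) * exp ((1 - \<alpha>) * h) / 6000 \<le> measure ?P (region R b)"
        using \<open>F \<in> \<F> xs\<close> that by (intro measure_region_ge[OF \<alpha> R(2) h]) (auto simp: \<F>_def)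
      finally show ?thesis
        using N by (simp add: field_simps)
    qed
    then have "prob (bad F) \<le> exp (- (32 * real (card F)))"
      using prob_regions_empty[of \<alpha> R F 32 N] \<alpha> R0 fin(3)[OF that] by (simp add: bad_def M_def)
    \<comment> \<open>The rays take up at most \<open>6 * (l + 1) = m / 2\<close> boxes, so
      \<open>F\<close> has at least \<open>m / 2\<close>.\<close>
    also have "\<dots> \<le> exp (- (16 * real m))"
      using that m by (simp add: \<F>_def)
    finally show ?thesis .
  qed
  have cover: "X \<in> (\<Union>xs\<in>walks (2 * m). \<Union>F\<in>\<F> xs. bad F)"
    if X: "X \<in> space ?M" "\<forall>i\<in>{..<N}. fst (X i) \<in> {0..R}" "\<not> ?D X" for X
  proof -
    interpret hyp_points N R l X
      by unfold_locales (use R h X(2) in auto)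
    obtain xs F where "empty_walk m xs F"
      using diameter_le_or_empty_walk[OF R(1) M, of m] X(3) by blast
    then have "xs \<in> walks (2 * m)" "F \<in> \<F> xs" "X \<in> bad F"
      using X(1) active_of_region by (auto simp: empty_walk_def \<F>_def bad_def)
    then show ?thesis
      by blast
  qed
  have D_sets: "{X \<in> space ?M. ?D X} \<in> sets ?M"
    by (rule sets_kpkvb_points_graph[of _ _ _ "\<lambda>G. \<forall>H\<in>graph_components (with_proj G).
      graph_diameter H \<le> ereal (real (8 * (12 * m * (M + 1) + 1)))"])
  have "1 - prob {X \<in> space ?M. ?D X} = prob (space ?M - {X \<in> space ?M. ?D X})"
    using D_sets by (simp add: prob_compl)
  also have "\<dots> \<le> prob (\<Union>xs\<in>walks (2 * m). \<Union>F\<in>\<F> xs. bad F)"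
  proof (rule finite_measure_mono_AE)
    have "AE X in ?M. \<forall>i\<in>{..<N}. fst (X i) \<in> {0..R}"
      unfolding M_def by (intro AE_finite_allI AE_PiM_component P AE_kpkvb_point_radius) auto
    then show "AE X in ?M. X \<in> space ?M - {X \<in> space ?M. ?D X} \<longrightarrow> X \<in> (\<Union>xs\<in>walks (2 * m). \<Union>F\<in>\<F> xs. bad F)"
      by eventually_elim (use cover in blast)
    show "(\<Union>xs\<in>walks (2 * m). \<Union>F\<in>\<F> xs. bad F) \<in> sets ?M"
      using finite_card_walks fin bad_sets by (intro sets.finite_UN) auto
  qed
  also have "\<dots> \<le> (\<Sum>xs\<in>walks (2 * m). \<Sum>F\<in>\<F> xs. prob (bad F))"
  proof -
    have "prob (\<Union>xs\<in>walks (2 * m). \<Union>F\<in>\<F> xs. bad F) \<le> (\<Sum>xs\<in>walks (2 * m). prob (\<Union>F\<in>\<F> xs. bad F))"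
      using finite_card_walks fin bad_sets by (intro finite_measure_subadditive_finite) auto
    also have "\<dots> \<le> (\<Sum>xs\<in>walks (2 * m). \<Sum>F\<in>\<F> xs. prob (bad F))"
      using fin bad_sets by (intro sum_mono finite_measure_subadditive_finite) auto
    finally show ?thesis .
  qed
  also have "\<dots> \<le> (\<Sum>xs\<in>walks (2 * m). 2 ^ (2 * m + 1) * exp (- (16 * real m)))"
  proof (rule sum_mono)
    fix xs assume xs: "xs \<in> walks (2 * m)"
    have "(\<Sum>F\<in>\<F> xs. prob (bad F)) \<le> real (card (\<F> xs)) * exp (- (16 * real m))"
      using sum_mono[of "\<F> xs" "\<lambda>F. prob (bad F)" "\<lambda>_. exp (- (16 * real m))"] bad_prob by simp
    also have "real (card (\<F> xs)) \<le> 2 ^ (2 * m + 1)"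
      using fin(2)[of xs] xs by (simp add: walks_def) (metis of_nat_le_iff of_nat_numeral of_nat_power power_Suc)
    finally show "(\<Sum>F\<in>\<F> xs. prob (bad F)) \<le> 2 ^ (2 * m + 1) * exp (- (16 * real m))"
      by simp
  qed
  also have "\<dots> \<le> 12 ^ (2 * m) * (2 ^ (2 * m + 1) * exp (- (16 * real m)))"
  proof -
    have "real (card (walks (2 * m))) \<le> 12 ^ (2 * m)"
      using finite_card_walks[of "2 * m"] by (metis of_nat_le_iff of_nat_numeral of_nat_power)
    then show ?thesis
      by (simp add: mult_right_mono)
  qed
  \<comment> \<open>\<open>576 = 12 ^ 2 * 2 ^ 2\<close>: per unit of \<open>m\<close>, two steps of
    the walk and the choice of which of two entries belong to \<open>F\<close>.\<close>
  also have "\<dots> = 2 * (576 * exp (- 16)) ^ m"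
  proof -
    have "exp (- (16 * real m)) = exp (- 16) ^ m"
      using exp_of_nat_mult[of m "- 16 :: real"] by (simp add: mult.commute)
    moreover have "(12 :: real) ^ (2 * m) = 144 ^ m" "(2 :: real) ^ (2 * m + 1) = 2 * 4 ^ m"
      by (simp_all add: power_mult)
    moreover have "(576 * exp (- 16 :: real)) ^ m = (144 * (4 * exp (- 16))) ^ m"
      by simp
    ultimately show ?thesis
      by (simp only: power_mult_distrib mult_ac)
  qed
  also have "\<dots> \<le> 2 * (1 / 2) ^ m"
  proof -
    have "(2::real) ^ 16 \<le> exp 1 ^ 16"
      using exp_ge_add_one_self[of 1] by (intro power_mono) auto
    also have "\<dots> = exp 16"
      by (simp add: exp_of_nat_mult[symmetric])
    finally have "65536 \<le> exp (16::real)"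
      by simp
    then have "576 * exp (- 16 :: real) \<le> 1 / 2"
      by (simp add: exp_minus field_simps)
    then show ?thesis
      by (intro mult_left_mono power_mono) auto
  qed
  finally show ?thesis
    by simp
qed

theorem theorem1:
  shows "\<exists>\<nu>0 :: real. \<forall>\<alpha> \<nu> :: real. \<alpha> > 0 \<longrightarrow> \<nu> > 0 \<longrightarrow>
    (1 / 2 < \<alpha> \<and> \<alpha> < 1 \<or> \<alpha> = 1 \<and> \<nu> > \<nu>0) \<longrightarrow>
    (\<exists>C :: real. (\<lambda>N. \<P>(X in kpkvb_points \<alpha> \<nu> N.
        \<forall>H \<in> graph_components (with_proj (kpkvb_graph \<nu> N X)). graph_diameter H \<le> ereal (C * ln (real N))))
      \<longlonglongrightarrow> 1)"
proof (rule exI[of _ 192000], intro allI impI)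
  \<comment> \<open>Boxes end at height \<open>h\<close> above the boundary of the disk, which makes them full enough if \<open>\<alpha> < 1\<close>.\<close>
  fix \<alpha> \<nu> :: real
  assume \<nu>: "0 < \<nu>" and cases: "1 / 2 < \<alpha> \<and> \<alpha> < 1 \<or> \<alpha> = 1 \<and> 192000 < \<nu>"
  then have \<alpha>: "1 / 2 \<le> \<alpha>" "\<alpha> \<le> 1"
    by auto
  obtain h where h: "0 \<le> h" "192000 \<le> \<nu> * exp ((1 - \<alpha>) * h)"
  proof (cases "\<alpha> = 1")
    case True
    then show ?thesis
      using cases that[of 0] by simp
  next
    case False
    define h where "h = max 0 (ln (192000 / \<nu>) / (1 - \<alpha>))"
    have "ln (192000 / \<nu>) \<le> (1 - \<alpha>) * h"
      using False \<alpha> by (simp add: h_def field_simps max_def)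
    then have "192000 / \<nu> \<le> exp ((1 - \<alpha>) * h)"
      using \<nu> by (metis divide_pos_pos exp_le_cancel_iff exp_ln zero_less_numeral)
    then show ?thesis
      using that[of h] \<nu> by (simp add: h_def field_simps)
  qed
  \<comment> \<open>A bottom box ends at height \<open>h\<close>, so the angle it spans exceeds the
    scale \<open>exp (- (R / 2))\<close> of cliques at the boundary by a factor of order
    \<open>exp h\<close>, independently of \<open>N\<close>.\<close>
  define M where "M = nat \<lceil>exp h\<rceil>"
  have M: "0 < M" "exp h \<le> real M"
    unfolding M_def by (auto simp: real_nat_ceiling_ge)
  \<comment> \<open>\<open>720 = 144 * 5\<close>, from \<open>12 * m = 144 * (l + 1)\<close> and
    \<open>l + 1 \<le> 5 * ln N\<close>.\<close>
  define C where "C = 8 * (720 * (real M + 1) + 1)"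
  let ?p = "\<lambda>N. \<P>(X in kpkvb_points \<alpha> \<nu> N.
        \<forall>H \<in> graph_components (with_proj (kpkvb_graph \<nu> N X)). graph_diameter H \<le> ereal (C * ln (real N)))"
  have lnN: "filterlim (\<lambda>N. ln (real N)) at_top sequentially"
    by (rule filterlim_compose[OF ln_at_top filterlim_real_sequentially])
  have ev: "\<forall>\<^sub>F N in sequentially. \<bar>ln \<nu>\<bar> + ln 1200 + 10 + h \<le> ln (real N)" "\<forall>\<^sub>F N in sequentially. 0 < N"
    using lnN eventually_gt_at_top[of 0] by (auto simp: filterlim_at_top)
  have bound: "\<forall>\<^sub>F N in sequentially. 1 - 2 * exp h * \<nu> / real N \<le> ?p N \<and> ?p N \<le> 1"
    using ev
  proof eventually_elim
    case (elim N)
    define R where "R = kpkvb_radius \<nu> N"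
    \<comment> \<open>The greatest depth whose outer radius is at most \<open>R - h\<close>; then
      \<open>2 ^ l\<close> is of order \<open>N\<close>.\<close>
    define l where "l = nat \<lfloor>(R - h - inner_radius R) / ln 2\<rfloor>"
    have ln1200: "0 \<le> ln (1200::real)"
      by (rule ln_ge_zero) simp
    have ln2: "1 / 2 \<le> ln (2::real)" "ln (2::real) \<le> 1"
      using ln2_ge_two_thirds ln_le_minus_one[of 2] by simp_all
    have R2: "R / 2 = ln (real N) - ln \<nu>"
      using elim \<nu> by (simp add: R_def kpkvb_radius_def ln_div)
    have gap: "R - h - inner_radius R = R / 2 + ln 1200 - h"
      by (simp add: inner_radius_def)
    have R_large: "2 * ln 1200 + 20 \<le> R" "h \<le> R / 2"
      using R2 elim(1) h(1) ln1200 by linarith+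
    then have "0 \<le> (R - h - inner_radius R) / ln 2"
      using ln1200 ln2 unfolding gap by (intro divide_nonneg_nonneg) linarith+
    then have l: "real l \<le> (R - h - inner_radius R) / ln 2" "(R - h - inner_radius R) / ln 2 \<le> real l + 1"
      unfolding l_def by linarith+
    have l1: "real l * ln 2 \<le> R / 2 + ln 1200 - h" "R / 2 + ln 1200 - h \<le> (real l + 1) * ln 2"
      using l ln2 unfolding gap by (simp_all add: field_simps)
    have out: "outer R l \<le> R - h"
      using l1(1) by (simp add: outer_def inner_radius_def)
    have "exp (R / 2 + ln 1200 - h) \<le> exp ((real l + 1) * ln 2)"
      using l1(2) by simp
    also have "\<dots> = 2 * 2 ^ l"
      by (simp add: exp_of_nat_mult distrib_right exp_add)
    also have "exp (R / 2 + ln 1200 - h) = exp (R / 2) * 1200 / exp h"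
      unfolding exp_diff exp_add by simp
    finally have pow: "1200 * exp (R / 2) \<le> 2 * 2 ^ l * exp h"
      by (simp only: divide_le_eq exp_gt_zero if_True mult.commute)
    have "5 * exp (R / 2) \<le> 600 * exp (R / 2)"
      by simp
    also have "\<dots> \<le> 2 ^ l * exp h"
      using pow by (simp add: mult.commute)
    also have "\<dots> \<le> 2 ^ l * real M"
      using M by simp
    finally have cells: "5 * exp (R / 2) \<le> 2 ^ l * real M" .
    define m where "m = 12 * (l + 1)"
    define K where "K = 8 * (12 * m * (M + 1) + 1)"
    have prob: "1 - 2 * (1 / 2) ^ m \<le> \<P>(X in kpkvb_points \<alpha> \<nu> N.
        \<forall>H\<in>graph_components (with_proj (kpkvb_graph \<nu> N X)). graph_diameter H \<le> ereal (real K))"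
      unfolding K_def
      by (rule prob_diameter_le[OF \<alpha> \<nu> elim(2) R_def R_large(1) h(1) out M(1) cells h(2) m_def])
    have "0 \<le> ln (1200::real)" "0 < R"
      using ln1200 R_large by linarith+
    then interpret prob_space "kpkvb_points \<alpha> \<nu> N"
      unfolding kpkvb_points_def using \<alpha> by (intro prob_space_PiM prob_space_kpkvb_point) (auto simp: R_def)
    have "real l * (1 / 2) \<le> real l * ln 2"
      using ln2 by (intro mult_left_mono) auto
    then have "real l + 1 \<le> 5 * ln (real N)"
      using l1(1) R2 elim(1) h(1) by linarith
    moreover have "1 \<le> ln (real N)"
      using elim(1) h(1) ln1200 by linarith
    ultimately have "8 * (144 * (real l + 1) * (real M + 1) + 1) \<le> 8 * (144 * (5 * ln (real N)) * (real M + 1) + ln (real N))"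
      by (intro mult_left_mono add_mono mult_right_mono) auto
    then have K: "real K \<le> C * ln (real N)"
      by (simp add: K_def m_def C_def algebra_simps)
    have "\<P>(X in kpkvb_points \<alpha> \<nu> N.
        \<forall>H\<in>graph_components (with_proj (kpkvb_graph \<nu> N X)). graph_diameter H \<le> ereal (real K)) \<le> ?p N"
    proof (rule finite_measure_mono)
      show "{X \<in> space (kpkvb_points \<alpha> \<nu> N). \<forall>H\<in>graph_components (with_proj (kpkvb_graph \<nu> N X)). graph_diameter H \<le> ereal (C * ln (real N))}
          \<in> events"
        by (rule sets_kpkvb_points_graph[of _ _ _ "\<lambda>G. \<forall>H\<in>graph_components (with_proj G). graph_diameter H \<le> ereal (C * ln (real N))"])
    qed (use K in \<open>auto intro: order_trans\<close>)
    moreover have "(1 / 2 :: real) ^ m \<le> exp h * \<nu> / real N"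
    proof -
      have "(1 / 2 :: real) ^ m \<le> (1 / 2) ^ Suc l"
        by (intro power_decreasing) (auto simp: m_def)
      also have "\<dots> = 1 / (2 * 2 ^ l)"
        by (simp add: power_one_over)
      also have "\<dots> \<le> exp h / (1200 * exp (R / 2))"
        using pow by (simp add: field_simps)
      also have "\<dots> \<le> exp h / exp (R / 2)"
        by (intro divide_left_mono) auto
      also have "\<dots> = exp h * \<nu> / real N"
        unfolding R2 using \<nu> elim(2) by (simp add: exp_diff)
      finally show ?thesis .
    qed
    ultimately show ?case
      using prob by simp
  qed
  have lim: "(\<lambda>N. 1 - 2 * exp h * \<nu> / real N) \<longlonglongrightarrow> 1"
    using tendsto_diff[OF tendsto_const[of 1] lim_const_over_n[of "2 * exp h * \<nu>"]] by simp
  have "?p \<longlonglongrightarrow> 1"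
    by (rule tendsto_sandwich[OF _ _ lim tendsto_const]) (use bound in \<open>auto elim: eventually_mono\<close>)
  then show "\<exists>C :: real. (\<lambda>N. \<P>(X in kpkvb_points \<alpha> \<nu> N.
        \<forall>H \<in> graph_components (with_proj (kpkvb_graph \<nu> N X)). graph_diameter H \<le> ereal (C * ln (real N))))
      \<longlonglongrightarrow> 1"
    by blast
qed

end
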